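(* Let $(M, \xi = \ker \alpha)$ be a co-oriented contact manifold. A submanifold $Y \subset M$ is contact coisotropic if and only if the ideal $I_Y = \{F \in C_c^{\infty}(M) \mid F|_Y = 0\}$ is a Lie subalgebra with respect to the contact Poisson bracket $\{-, -\}_{\alpha}$.
   Context: A co-oriented contact manifold $(M^{2n+1},\xi=\ker\alpha)$ is a manifold with a hyperplane field $\xi$ that is globally the kernel of a 1-form $\alpha$ (a contact form) such that $\alpha\wedge(d\alpha)^n$ is a volume form; then $d\alpha|_\xi$ is non-degenerate. A submanifold $Y \subset M$ is contact coisotropic if for every $p\in Y$, $(T_pY\cap\xi_p)^{\perp_{d\alpha}}\subset T_pY\cap \xi_p$, where $\perp_{d\alpha}$ denotes the symplectic orthogonal complement inside $\xi_p$ with respect to $d\alpha|_{\xi}$. The Reeb vector field $R_\alpha$ is determined by $\alpha(R_\alpha)=1$, $i_{R_\alpha}d\alpha=0$. For a smooth function $F:M\to\mathbb{R}$, the contact vector field $X_F$ is determined by $\alpha(X_F)=F$ and $i_{X_F}d\alpha=dF(R_\alpha)\alpha-dF$. The contact Poisson bracket is $\{F,G\}_\alpha=dF(X_G)-dG(R_\alpha)F$. $C_c^\infty(M)$ denotes the compactly supported smooth functions on $M$. *)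

theory Defs
  imports "HOL-Analysis.Analysis"
begin

section \<open>Smooth maps between Euclidean spaces\<close>

text \<open>Both notions are meant for open \<open>S\<close> only. \<open>Ck_on k S f\<close> says that all iterated directional
  derivatives of order \<open>< k\<close> are differentiable and those of order \<open>k\<close> are continuous.\<close>

primrec Ck_on ::
  "nat \<Rightarrow> 'e::real_normed_vector set \<Rightarrow> ('e \<Rightarrow> 'f::real_normed_vector) \<Rightarrow> bool" where
  "Ck_on 0 S f \<longleftrightarrow> continuous_on S f"
| "Ck_on (Suc k) S f \<longleftrightarrow>
     (\<forall>x\<in>S. f differentiable (at x)) \<and>
     (\<forall>v. Ck_on k S (\<lambda>x. frechet_derivative f (at x) v))"

definition smooth_on ::
  "'e::real_normed_vector set \<Rightarrow> ('e \<Rightarrow> 'f::real_normed_vector) \<Rightarrow> bool" where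
  "smooth_on S f \<longleftrightarrow> (\<forall>k. Ck_on k S f)"

section \<open>Smooth manifolds\<close>

text \<open>The manifold \<open>M\<close> is a whole (Hausdorff, second countable) type \<open>'a\<close>. A chart is a pair of its
  domain and a map into the model space \<open>'e\<close>; the values of the map off the domain are irrelevant.\<close>

type_synonym ('a, 'e) chart = "'a set \<times> ('a \<Rightarrow> 'e)"

abbreviation chart_dom :: "('a, 'e) chart \<Rightarrow> 'a set" where
  "chart_dom \<equiv> fst"

abbreviation chart_map :: "('a, 'e) chart \<Rightarrow> 'a \<Rightarrow> 'e" where
  "chart_map \<equiv> snd"

definition chart_inv :: "('a, 'e) chart \<Rightarrow> 'e \<Rightarrow> 'a" where
  "chart_inv c = inv_into (chart_dom c) (chart_map c)"

definition chart_ran :: "('a, 'e) chart \<Rightarrow> 'e set" where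
  "chart_ran c = chart_map c ` chart_dom c"

definition is_chart :: "('a::topological_space, 'e::euclidean_space) chart \<Rightarrow> bool" where
  "is_chart c \<longleftrightarrow> open (chart_dom c) \<and> open (chart_ran c) \<and>
     homeomorphism (chart_dom c) (chart_ran c) (chart_map c) (chart_inv c)"

definition transition :: "('a, 'e) chart \<Rightarrow> ('a, 'e) chart \<Rightarrow> 'e \<Rightarrow> 'e" where
  "transition c d = chart_map d \<circ> chart_inv c"

definition smooth_compatible ::
  "('a, 'e::euclidean_space) chart \<Rightarrow> ('a, 'e) chart \<Rightarrow> bool" where
  "smooth_compatible c d \<longleftrightarrow>
     smooth_on (chart_map c ` (chart_dom c \<inter> chart_dom d)) (transition c d) \<and>
     smooth_on (chart_map d ` (chart_dom c \<inter> chart_dom d)) (transition d c)"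

text \<open>A smooth structure is a maximal smooth atlas.\<close>

definition smooth_structure ::
  "('a::{t2_space, second_countable_topology}, 'e::euclidean_space) chart set \<Rightarrow> bool" where
  "smooth_structure A \<longleftrightarrow>
     (\<forall>c\<in>A. is_chart c) \<and>
     (\<Union>c\<in>A. chart_dom c) = UNIV \<and>
     (\<forall>c\<in>A. \<forall>d\<in>A. smooth_compatible c d) \<and>
     (\<forall>c. is_chart c \<and> (\<forall>d\<in>A. smooth_compatible c d) \<longrightarrow> c \<in> A)"

definition charts_at :: "('a, 'e) chart set \<Rightarrow> 'a \<Rightarrow> ('a, 'e) chart set" where
  "charts_at A p = {c \<in> A. p \<in> chart_dom c}"

text \<open>An arbitrary chart around \<open>p\<close>; it is only used to define objects that are independent of
  the chart.\<close>

definition some_chart :: "('a, 'e) chart set \<Rightarrow> 'a \<Rightarrow> ('a, 'e) chart" where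
  "some_chart A p = (SOME c. c \<in> charts_at A p)"

definition smooth_function ::
  "('a, 'e::euclidean_space) chart set \<Rightarrow> ('a \<Rightarrow> real) \<Rightarrow> bool" where
  "smooth_function A F \<longleftrightarrow> (\<forall>c\<in>A. smooth_on (chart_ran c) (F \<circ> chart_inv c))"

definition compactly_supported_smooth ::
  "('a::topological_space, 'e::euclidean_space) chart set \<Rightarrow> ('a \<Rightarrow> real) set" where
  "compactly_supported_smooth A = {F. smooth_function A F \<and> compact (closure {p. F p \<noteq> 0})}"

section \<open>Tangent vectors\<close>

text \<open>A tangent vector at \<open>p\<close> is the family of its coordinate vectors in all charts around \<open>p\<close>, which
  are related by the derivatives of the transition maps. The components at all other charts are
  set to \<open>0\<close>, so that equality of tangent vectors is equality of families. The vector space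
  operations are the componentwise ones.\<close>

type_synonym ('a, 'e) tvector = "('a, 'e) chart \<Rightarrow> 'e"

definition tangent_space ::
  "('a, 'e::euclidean_space) chart set \<Rightarrow> 'a \<Rightarrow> ('a, 'e) tvector set" where
  "tangent_space A p = {v.
     (\<forall>c\<in>charts_at A p. \<forall>d\<in>charts_at A p.
        v d = frechet_derivative (transition c d) (at (chart_map c p)) (v c)) \<and>
     (\<forall>c. c \<notin> charts_at A p \<longrightarrow> v c = 0)}"

text \<open>The tangent vector at \<open>p\<close> whose coordinate vector in the chart \<open>c\<close> around \<open>p\<close> is \<open>e\<close>.\<close>

definition tvector_of ::
  "('a, 'e::euclidean_space) chart set \<Rightarrow> ('a, 'e) chart \<Rightarrow> 'a \<Rightarrow> 'e \<Rightarrow> ('a, 'e) tvector" where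
  "tvector_of A c p e = (\<lambda>d.
     if d \<in> charts_at A p then frechet_derivative (transition c d) (at (chart_map c p)) e else 0)"

definition differential ::
  "('a, 'e::euclidean_space) chart set \<Rightarrow> ('a \<Rightarrow> real) \<Rightarrow> 'a \<Rightarrow> ('a, 'e) tvector \<Rightarrow> real" where
  "differential A F p v = (let c = some_chart A p in
     frechet_derivative (F \<circ> chart_inv c) (at (chart_map c p)) (v c))"

section \<open>Differential forms\<close>

text \<open>A 1-form assigns to each point a linear functional on the tangent space; its values off the
  tangent space are irrelevant.\<close>

type_synonym ('a, 'e) one_form = "'a \<Rightarrow> ('a, 'e) tvector \<Rightarrow> real"

definition local_rep ::
  "('a, 'e::euclidean_space) chart set \<Rightarrow> ('a, 'e) one_form \<Rightarrow> ('a, 'e) chart \<Rightarrow> 'e \<Rightarrow> 'e \<Rightarrow> real" where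
  "local_rep A \<alpha> c x e = \<alpha> (chart_inv c x) (tvector_of A c (chart_inv c x) e)"

definition smooth_one_form ::
  "('a, 'e::euclidean_space) chart set \<Rightarrow> ('a, 'e) one_form \<Rightarrow> bool" where
  "smooth_one_form A \<alpha> \<longleftrightarrow>
     (\<forall>p. \<forall>u\<in>tangent_space A p. \<forall>v\<in>tangent_space A p. \<forall>a b.
        \<alpha> p (\<lambda>c. a *\<^sub>R u c + b *\<^sub>R v c) = a * \<alpha> p u + b * \<alpha> p v) \<and>
     (\<forall>c\<in>A. \<forall>e. smooth_on (chart_ran c) (\<lambda>x. local_rep A \<alpha> c x e))"

text \<open>In a chart, \<open>d\<alpha>(u, v) = D\<^sub>u(\<alpha>(v)) - D\<^sub>v(\<alpha>(u))\<close> for \<open>u\<close>, \<open>v\<close> extended to vector fields with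
  constant coefficients.\<close>

definition ext_deriv ::
  "('a, 'e::euclidean_space) chart set \<Rightarrow> ('a, 'e) one_form \<Rightarrow>
     'a \<Rightarrow> ('a, 'e) tvector \<Rightarrow> ('a, 'e) tvector \<Rightarrow> real" where
  "ext_deriv A \<alpha> p u v = (let c = some_chart A p in
     frechet_derivative (\<lambda>x. local_rep A \<alpha> c x (v c)) (at (chart_map c p)) (u c) -
     frechet_derivative (\<lambda>x. local_rep A \<alpha> c x (u c)) (at (chart_map c p)) (v c))"

text \<open>Alternating \<open>k\<close>-forms on a vector space are functions of a sequence of vectors that depend on
  its first \<open>k\<close> members only.\<close>

definition wedge ::
  "nat \<Rightarrow> nat \<Rightarrow> ((nat \<Rightarrow> 'v) \<Rightarrow> real) \<Rightarrow> ((nat \<Rightarrow> 'v) \<Rightarrow> real) \<Rightarrow> (nat \<Rightarrow> 'v) \<Rightarrow> real" where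
  "wedge k l \<omega> \<eta> v =
     (\<Sum>\<sigma> | \<sigma> permutes {..<k + l}.
        of_int (sign \<sigma>) * \<omega> (\<lambda>i. v (\<sigma> i)) * \<eta> (\<lambda>i. v (\<sigma> (k + i)))) / (fact k * fact l)"

primrec wedge_power :: "nat \<Rightarrow> ((nat \<Rightarrow> 'v) \<Rightarrow> real) \<Rightarrow> nat \<Rightarrow> (nat \<Rightarrow> 'v) \<Rightarrow> real" where
  "wedge_power k \<omega> 0 = (\<lambda>v. 1)"
| "wedge_power k \<omega> (Suc m) = wedge k (k * m) \<omega> (wedge_power k \<omega> m)"

section \<open>Contact manifolds\<close>

text \<open>The form \<open>\<alpha> \<and> (d\<alpha>)\<^sup>n\<close> at the point \<open>p\<close>.\<close>

definition contact_volume ::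
  "('a, 'e::euclidean_space) chart set \<Rightarrow> ('a, 'e) one_form \<Rightarrow> nat \<Rightarrow>
     'a \<Rightarrow> (nat \<Rightarrow> ('a, 'e) tvector) \<Rightarrow> real" where
  "contact_volume A \<alpha> n p =
     wedge 1 (2 * n) (\<lambda>v. \<alpha> p (v 0)) (wedge_power 2 (\<lambda>v. ext_deriv A \<alpha> p (v 0) (v 1)) n)"

text \<open>The last condition says that the top-degree form \<open>\<alpha> \<and> (d\<alpha>)\<^sup>n\<close> vanishes at no point.\<close>

definition contact_manifold ::
  "('a::{t2_space, second_countable_topology}, 'e::euclidean_space) chart set \<Rightarrow> nat \<Rightarrow>
     ('a, 'e) one_form \<Rightarrow> bool" where
  "contact_manifold A n \<alpha> \<longleftrightarrow>
     smooth_structure A \<and> DIM('e) = 2 * n + 1 \<and> smooth_one_form A \<alpha> \<and>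
     (\<forall>p. \<exists>v. (\<forall>i<2 * n + 1. v i \<in> tangent_space A p) \<and> contact_volume A \<alpha> n p v \<noteq> 0)"

definition contact_hyperplane ::
  "('a, 'e::euclidean_space) chart set \<Rightarrow> ('a, 'e) one_form \<Rightarrow> 'a \<Rightarrow> ('a, 'e) tvector set" where
  "contact_hyperplane A \<alpha> p = {v \<in> tangent_space A p. \<alpha> p v = 0}"

text \<open>On a contact manifold the vectors described below exist and are unique.\<close>

definition reeb ::
  "('a, 'e::euclidean_space) chart set \<Rightarrow> ('a, 'e) one_form \<Rightarrow> 'a \<Rightarrow> ('a, 'e) tvector" where
  "reeb A \<alpha> p = (THE v. v \<in> tangent_space A p \<and> \<alpha> p v = 1 \<and>
     (\<forall>w\<in>tangent_space A p. ext_deriv A \<alpha> p v w = 0))"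

definition contact_vector_field ::
  "('a, 'e::euclidean_space) chart set \<Rightarrow> ('a, 'e) one_form \<Rightarrow> ('a \<Rightarrow> real) \<Rightarrow>
     'a \<Rightarrow> ('a, 'e) tvector" where
  "contact_vector_field A \<alpha> F p = (THE v. v \<in> tangent_space A p \<and> \<alpha> p v = F p \<and>
     (\<forall>w\<in>tangent_space A p. ext_deriv A \<alpha> p v w =
        differential A F p (reeb A \<alpha> p) * \<alpha> p w - differential A F p w))"

definition contact_bracket ::
  "('a, 'e::euclidean_space) chart set \<Rightarrow> ('a, 'e) one_form \<Rightarrow>
     ('a \<Rightarrow> real) \<Rightarrow> ('a \<Rightarrow> real) \<Rightarrow> 'a \<Rightarrow> real" where
  "contact_bracket A \<alpha> F G p =
     differential A F p (contact_vector_field A \<alpha> G p) - differential A G p (reeb A \<alpha> p) * F p"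

section \<open>Submanifolds\<close>

text \<open>\<open>c\<close> is a chart of \<open>M\<close> that maps \<open>Y\<close> onto the part of the linear subspace \<open>S\<close> in its range.\<close>

definition slice_chart ::
  "('a, 'e::euclidean_space) chart set \<Rightarrow> 'a set \<Rightarrow> ('a, 'e) chart \<Rightarrow> 'e set \<Rightarrow> bool" where
  "slice_chart A Y c S \<longleftrightarrow> c \<in> A \<and> subspace S \<and>
     chart_map c ` (Y \<inter> chart_dom c) = S \<inter> chart_ran c"

text \<open>Submanifolds are embedded, but not necessarily closed as subsets.\<close>

definition submanifold ::
  "('a, 'e::euclidean_space) chart set \<Rightarrow> 'a set \<Rightarrow> bool" where
  "submanifold A Y \<longleftrightarrow>
     (\<exists>k. \<forall>p\<in>Y. \<exists>c S. slice_chart A Y c S \<and> p \<in> chart_dom c \<and> dim S = k)"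

definition sub_tangent_space ::
  "('a, 'e::euclidean_space) chart set \<Rightarrow> 'a set \<Rightarrow> 'a \<Rightarrow> ('a, 'e) tvector set" where
  "sub_tangent_space A Y p = {v \<in> tangent_space A p.
     \<exists>c S. slice_chart A Y c S \<and> p \<in> chart_dom c \<and> v c \<in> S}"

definition symplectic_orthogonal ::
  "('a, 'e::euclidean_space) chart set \<Rightarrow> ('a, 'e) one_form \<Rightarrow> 'a \<Rightarrow>
     ('a, 'e) tvector set \<Rightarrow> ('a, 'e) tvector set" where
  "symplectic_orthogonal A \<alpha> p W =
     {v \<in> contact_hyperplane A \<alpha> p. \<forall>w\<in>W. ext_deriv A \<alpha> p v w = 0}"

definition contact_coisotropic ::
  "('a, 'e::euclidean_space) chart set \<Rightarrow> ('a, 'e) one_form \<Rightarrow> 'a set \<Rightarrow> bool" where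
  "contact_coisotropic A \<alpha> Y \<longleftrightarrow> (\<forall>p\<in>Y.
     symplectic_orthogonal A \<alpha> p (sub_tangent_space A Y p \<inter> contact_hyperplane A \<alpha> p)
       \<subseteq> sub_tangent_space A Y p \<inter> contact_hyperplane A \<alpha> p)"

section \<open>Vanishing ideals and Lie subalgebras\<close>

definition vanishing_ideal ::
  "('a::topological_space, 'e::euclidean_space) chart set \<Rightarrow> 'a set \<Rightarrow> ('a \<Rightarrow> real) set" where
  "vanishing_ideal A Y = {F \<in> compactly_supported_smooth A. \<forall>p\<in>Y. F p = 0}"

text \<open>\<open>V\<close> is a linear subspace of the function space \<open>L\<close> closed under the bracket \<open>B\<close> of \<open>L\<close>.\<close>

definition lie_subalgebra ::
  "(('a \<Rightarrow> real) \<Rightarrow> ('a \<Rightarrow> real) \<Rightarrow> 'a \<Rightarrow> real) \<Rightarrow> ('a \<Rightarrow> real) set \<Rightarrow> ('a \<Rightarrow> real) set \<Rightarrow> bool" where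
  "lie_subalgebra B L V \<longleftrightarrow> V \<subseteq> L \<and> (\<lambda>_. 0) \<in> V \<and>
     (\<forall>F\<in>V. \<forall>G\<in>V. (\<lambda>p. F p + G p) \<in> V) \<and>
     (\<forall>a. \<forall>F\<in>V. (\<lambda>p. a * F p) \<in> V) \<and>
     (\<forall>F\<in>V. \<forall>G\<in>V. B F G \<in> V)"

end

theory Submission
  imports Defs
begin

text \<open>
  Write \<open>I\<close> for the vanishing ideal of \<open>Y\<close> and let \<open>p \<in> Y\<close>. Bump functions in a slice chart extend
  every covector at \<open>p\<close> that kills \<open>T\<^sub>pY\<close> to a member of \<open>I\<close>; hence \<open>T\<^sub>pY\<close> consists of the vectors
  killed by all \<open>dF\<^sub>p\<close> with \<open>F \<in> I\<close> (\<open>sub_tangent_space_iff\<close>). For \<open>F, G \<in> I\<close> the bracket at \<open>p\<close> reduces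
  to \<open>dF(X\<^sub>G)\<close>, because \<open>F p = 0\<close>. So \<open>I\<close> is closed under the bracket iff all the vectors
  \<open>X\<^sub>G(p)\<close>, \<open>G \<in> I\<close>, are tangent to \<open>Y\<close>, and it remains to see that these vectors make up the
  orthogonal complement of \<open>T\<^sub>pY \<inter> \<xi>\<^sub>p\<close>. Since \<open>G p = 0\<close>, the vector \<open>X\<^sub>G(p)\<close> lies in \<open>\<xi>\<^sub>p\<close>, and
  \<open>d\<alpha>(X\<^sub>G, w) = - dG(w)\<close> for \<open>w \<in> \<xi>\<^sub>p\<close>, which vanishes if \<open>w \<in> T\<^sub>pY\<close>. Conversely, for \<open>v\<close> in the complement the
  functional \<open>- d\<alpha>(v, _)\<close> on \<open>\<xi>\<^sub>p\<close> vanishes on \<open>T\<^sub>pY \<inter> \<xi>\<^sub>p\<close>, so a multiple of \<open>\<alpha>\<close> can be added to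
  make it vanish on \<open>T\<^sub>pY\<close>; extended to \<open>G \<in> I\<close>, it gives \<open>X\<^sub>G(p) = v\<close>
  (\<open>orthogonal_is_contact_vector\<close>).

  The rest is the analytic basis of this argument: the bracket of two smooth functions must be
  smooth, and the Reeb and contact vectors must exist. Non-vanishing of \<open>\<alpha> \<and> (d\<alpha>)\<^sup>n\<close> makes \<open>d\<alpha>\<close>
  non-degenerate on \<open>\<xi>\<close> (\<open>contact_form_degenerate\<close>), and then
  \<open>V \<mapsto> i\<^sub>V d\<alpha> + \<alpha>(V) \<alpha>\<close> is an isomorphism onto the covectors. In a chart, Reeb and contact vectors
  are therefore the solutions of linear systems with smooth coefficients, and these are
  smooth (\<open>smooth_on_linear_solution\<close>). That the chart does not matter for \<open>d\<alpha>\<close> rests on the symmetry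
  of the second derivatives of transition maps (\<open>dlrep_transition\<close>).
\<close>

section \<open>Calculus of smooth maps\<close>

lemma linear_sum_Basis:
  fixes f :: "'e::euclidean_space \<Rightarrow> 'f::real_vector"
  assumes "linear f"
  shows "f x = (\<Sum>b\<in>Basis. (x \<bullet> b) *\<^sub>R f b)"
proof -
  interpret linear f by fact
  have "f (\<Sum>b\<in>Basis. (x \<bullet> b) *\<^sub>R b) = (\<Sum>b\<in>Basis. (x \<bullet> b) *\<^sub>R f b)"
    by (simp add: sum scaleR)
  then show ?thesis by (simp only: euclidean_representation)
qed

lemma Ck_on_cong:
  assumes "open S" "\<And>x. x \<in> S \<Longrightarrow> f x = g x" "Ck_on k S f"
  shows "Ck_on k S g"
  using assms(2,3)
proof (induction k arbitrary: f g)
  case 0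
  then show ?case using continuous_on_cong by fastforce
next
  case (Suc k)
  have D: "g differentiable (at x)" if x: "x \<in> S" for x
  proof -
    obtain f' where "(f has_derivative f') (at x)"
      using Suc.prems(2) x by (auto simp: differentiable_def)
    then have "(g has_derivative f') (at x)"
      by (rule has_derivative_transform_within_open[OF _ assms(1) x Suc.prems(1)])
    then show ?thesis by (auto simp: differentiable_def)
  qed
  have "frechet_derivative f (at x) v = frechet_derivative g (at x) v" if "x \<in> S" for x v
    using frechet_derivative_transform_within_open[of f x S g] Suc.prems assms(1) that by auto
  then have "Ck_on k S (\<lambda>x. frechet_derivative g (at x) v)" for v
    using Suc.IH[of "\<lambda>x. frechet_derivative f (at x) v" "\<lambda>x. frechet_derivative g (at x) v"]
      Suc.prems(2) by simp
  then show ?case using D by simp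
qed

lemma Ck_on_SucI:
  assumes "open S" "\<And>x. x \<in> S \<Longrightarrow> (f has_derivative D x) (at x)"
    and "\<And>v. Ck_on k S (\<lambda>x. D x v)"
  shows "Ck_on (Suc k) S f"
proof -
  have "Ck_on k S (\<lambda>x. frechet_derivative f (at x) v)" for v
    by (rule Ck_on_cong[OF assms(1) _ assms(3)[of v]])
       (simp add: frechet_derivative_at[OF assms(2), symmetric])
  then show ?thesis using assms(2) by (auto simp: differentiable_def)
qed

lemma Ck_on_subset: "Ck_on k S f \<Longrightarrow> T \<subseteq> S \<Longrightarrow> Ck_on k T f"
  by (induction k arbitrary: f) (auto intro: continuous_on_subset)

lemma Ck_on_imp_differentiable: "Ck_on (Suc k) S f \<Longrightarrow> x \<in> S \<Longrightarrow> f differentiable (at x)"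
  by simp

lemma Ck_on_Suc_imp: "Ck_on (Suc k) S f \<Longrightarrow> Ck_on k S f"
proof (induction k arbitrary: f)
  case 0
  then show ?case
    by (auto intro!: continuous_at_imp_continuous_on differentiable_imp_continuous_within)
qed auto

lemma Ck_on_imp_continuous_on: "Ck_on k S f \<Longrightarrow> continuous_on S f"
  by (induction k) (auto dest: Ck_on_Suc_imp simp del: Ck_on.simps(2))

lemma Ck_on_locally:
  assumes "\<And>x. x \<in> S \<Longrightarrow> \<exists>T. open T \<and> x \<in> T \<and> Ck_on k T f"
  shows "Ck_on k S f"
  using assms
proof (induction k arbitrary: f)
  case 0
  show ?case
  proof (simp, rule continuous_at_imp_continuous_on, rule ballI)
    fix x assume "x \<in> S"
    then obtain T where "open T" "x \<in> T" "continuous_on T f" using 0 by auto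
    then show "isCont f x" by (simp add: continuous_on_eq_continuous_at)
  qed
next
  case (Suc k)
  show ?case
  proof (simp, intro conjI ballI allI)
    show "f differentiable (at x)" if "x \<in> S" for x
      using Suc.prems[OF that] by auto
    show "Ck_on k S (\<lambda>x. frechet_derivative f (at x) v)" for v
      by (rule Suc.IH) (use Suc.prems in fastforce)
  qed
qed

lemma Ck_on_const: "Ck_on k S (\<lambda>x. c)"
  by (induction k arbitrary: c) auto

lemma Ck_on_bounded_linear_comp:
  assumes "open S" "bounded_linear h" "Ck_on k S f"
  shows "Ck_on k S (\<lambda>x. h (f x))"
  using assms(3)
proof (induction k arbitrary: f)
  case 0
  then show ?case using assms(2) bounded_linear.continuous_on by auto
next
  case (Suc k)
  have D: "((\<lambda>x. h (f x)) has_derivative (\<lambda>v. h (frechet_derivative f (at x) v))) (at x)"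
    if "x \<in> S" for x
    using Suc.prems that assms(2) bounded_linear.has_derivative frechet_derivative_works by fastforce
  show ?case
    by (rule Ck_on_SucI[OF assms(1) D]) (use Suc in \<open>auto\<close>)
qed

lemma Ck_on_ident: "open S \<Longrightarrow> Ck_on k S (\<lambda>x. x)"
  by (cases k) (auto simp: Ck_on_const)

lemma Ck_on_add:
  assumes "open S" "Ck_on k S f" "Ck_on k S g"
  shows "Ck_on k S (\<lambda>x. f x + g x)"
  using assms(2,3)
proof (induction k arbitrary: f g)
  case 0
  then show ?case by (auto intro: continuous_on_add)
next
  case (Suc k)
  have D: "((\<lambda>x. f x + g x) has_derivative
      (\<lambda>v. frechet_derivative f (at x) v + frechet_derivative g (at x) v)) (at x)"
    if "x \<in> S" for x
    using Suc.prems that by (intro has_derivative_add) (auto simp: frechet_derivative_works)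
  show ?case
    by (rule Ck_on_SucI[OF assms(1) D]) (use Suc in \<open>auto\<close>)
qed

lemma Ck_on_sum:
  assumes "open S" "\<And>i. i \<in> I \<Longrightarrow> Ck_on k S (f i)"
  shows "Ck_on k S (\<lambda>x. \<Sum>i\<in>I. f i x)"
  using assms(2)
  by (induction I rule: infinite_finite_induct) (auto intro: Ck_on_add Ck_on_const assms(1))

lemma Ck_on_bilinear:
  assumes "open S" "bounded_bilinear h" "Ck_on k S f" "Ck_on k S g"
  shows "Ck_on k S (\<lambda>x. h (f x) (g x))"
  using assms(3,4)
proof (induction k arbitrary: f g)
  case 0
  then show ?case using assms(2) bounded_bilinear.continuous_on by auto
next
  case (Suc k)
  have D: "((\<lambda>x. h (f x) (g x)) has_derivative
      (\<lambda>v. h (f x) (frechet_derivative g (at x) v) + h (frechet_derivative f (at x) v) (g x))) (at x)"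
    if "x \<in> S" for x
    using Suc.prems that
    by (intro bounded_bilinear.FDERIV[OF assms(2)]) (auto simp: frechet_derivative_works)
  have "Ck_on k S f" "Ck_on k S g" using Suc.prems Ck_on_Suc_imp by blast+
  then show ?case
    using Suc.prems by (intro Ck_on_SucI[OF assms(1) D] Ck_on_add assms(1) Suc.IH) simp_all
qed

text \<open>Directional derivatives along a varying direction are reduced to those along a basis, so that
  the chain rule expresses the derivative of a composition by sums of products.\<close>

lemma Ck_on_compose:
  fixes f :: "'e::real_normed_vector \<Rightarrow> 'f::euclidean_space"
    and g :: "'f \<Rightarrow> 'g::real_normed_vector"
  assumes "open S" "open T" "f ` S \<subseteq> T" "Ck_on k S f" "Ck_on k T g"
  shows "Ck_on k S (g \<circ> f)"
  using assms(4,5)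
proof (induction k arbitrary: g)
  case 0
  then show ?case using assms(3) continuous_on_compose2[of T g S f] by (simp add: o_def)
next
  case (Suc k)
  have dg: "(g has_derivative frechet_derivative g (at (f x))) (at (f x))" if "x \<in> S" for x
    using Suc.prems assms(3) that by (auto simp flip: frechet_derivative_works)
  have df: "(f has_derivative frechet_derivative f (at x)) (at x)" if "x \<in> S" for x
    using Suc.prems that by (auto simp flip: frechet_derivative_works)
  have D: "(g \<circ> f has_derivative
      frechet_derivative g (at (f x)) \<circ> frechet_derivative f (at x)) (at x)" if "x \<in> S" for x
    by (rule diff_chain_at[OF df[OF that] dg[OF that]])
  have exp: "frechet_derivative (g \<circ> f) (at x) v =
      (\<Sum>b\<in>Basis. (frechet_derivative f (at x) v \<bullet> b) *\<^sub>R
         ((\<lambda>y. frechet_derivative g (at y) b) \<circ> f) x)" if "x \<in> S" for x v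
  proof -
    have "linear (frechet_derivative g (at (f x)))"
      using dg[OF that] has_derivative_linear by blast
    from linear_sum_Basis[OF this, of "frechet_derivative f (at x) v"] show ?thesis
      using D[OF that, THEN frechet_derivative_at, THEN fun_cong, of v] by simp
  qed
  have "Ck_on k S (\<lambda>x. frechet_derivative (g \<circ> f) (at x) v)" for v
  proof (rule Ck_on_cong[OF assms(1) exp[symmetric]])
    have fk: "Ck_on k S f" "\<And>v. Ck_on k S (\<lambda>x. frechet_derivative f (at x) v)"
      and gk: "\<And>v. Ck_on k T (\<lambda>x. frechet_derivative g (at x) v)"
      using Suc.prems Ck_on_Suc_imp by (auto simp del: Ck_on.simps(2)) (auto simp: )
    show "Ck_on k S (\<lambda>x. \<Sum>b\<in>Basis. (frechet_derivative f (at x) v \<bullet> b) *\<^sub>R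
         ((\<lambda>y. frechet_derivative g (at y) b) \<circ> f) x)"
      by (intro Ck_on_sum Ck_on_bilinear[OF _ bounded_bilinear_scaleR] assms(1)
          Ck_on_bounded_linear_comp[OF _ bounded_linear_inner_left] fk Suc.IH gk)
  qed simp
  then show ?case using D unfolding Ck_on.simps differentiable_def by blast
qed

lemma smooth_on_cong:
  "open S \<Longrightarrow> (\<And>x. x \<in> S \<Longrightarrow> f x = g x) \<Longrightarrow> smooth_on S f \<Longrightarrow> smooth_on S g"
  unfolding smooth_on_def using Ck_on_cong by blast

lemma smooth_on_locally:
  "(\<And>x. x \<in> S \<Longrightarrow> \<exists>T. open T \<and> x \<in> T \<and> smooth_on T f) \<Longrightarrow> smooth_on S f"
  unfolding smooth_on_def by (meson Ck_on_locally)

lemma smooth_on_imp_differentiable: "smooth_on S f \<Longrightarrow> x \<in> S \<Longrightarrow> f differentiable (at x)"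
  unfolding smooth_on_def using Ck_on_imp_differentiable by blast

lemma smooth_on_imp_has_derivative:
  "smooth_on S f \<Longrightarrow> x \<in> S \<Longrightarrow> (f has_derivative frechet_derivative f (at x)) (at x)"
  using smooth_on_imp_differentiable frechet_derivative_works by blast

lemma smooth_on_imp_continuous_on: "smooth_on S f \<Longrightarrow> continuous_on S f"
  unfolding smooth_on_def using Ck_on_imp_continuous_on by blast

lemma smooth_on_derivative: "smooth_on S f \<Longrightarrow> smooth_on S (\<lambda>x. frechet_derivative f (at x) v)"
  unfolding smooth_on_def by (metis Ck_on.simps(2))

lemma smooth_on_const: "smooth_on S (\<lambda>x. c)"
  unfolding smooth_on_def using Ck_on_const by blast

lemma smooth_on_ident: "open S \<Longrightarrow> smooth_on S (\<lambda>x. x)"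
  unfolding smooth_on_def using Ck_on_ident by blast

lemma smooth_on_bounded_linear_comp:
  "open S \<Longrightarrow> bounded_linear h \<Longrightarrow> smooth_on S f \<Longrightarrow> smooth_on S (\<lambda>x. h (f x))"
  unfolding smooth_on_def by (intro allI Ck_on_bounded_linear_comp[of S h]) simp_all

lemma smooth_on_add:
  "open S \<Longrightarrow> smooth_on S f \<Longrightarrow> smooth_on S g \<Longrightarrow> smooth_on S (\<lambda>x. f x + g x)"
  unfolding smooth_on_def by (intro allI Ck_on_add) simp_all

lemma smooth_on_minus: "open S \<Longrightarrow> smooth_on S f \<Longrightarrow> smooth_on S (\<lambda>x. - f x)"
  by (rule smooth_on_bounded_linear_comp[OF _ bounded_linear_minus[OF bounded_linear_ident]])

lemma smooth_on_diff:
  "open S \<Longrightarrow> smooth_on S f \<Longrightarrow> smooth_on S g \<Longrightarrow> smooth_on S (\<lambda>x. f x - g x)"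
  using smooth_on_add[OF _ _ smooth_on_minus] by fastforce

lemma smooth_on_sum:
  "open S \<Longrightarrow> (\<And>i. i \<in> I \<Longrightarrow> smooth_on S (f i)) \<Longrightarrow> smooth_on S (\<lambda>x. \<Sum>i\<in>I. f i x)"
  unfolding smooth_on_def by (intro allI Ck_on_sum) simp_all

lemma smooth_on_scaleR:
  "open S \<Longrightarrow> smooth_on S f \<Longrightarrow> smooth_on S g \<Longrightarrow> smooth_on S (\<lambda>x. f x *\<^sub>R g x)"
  unfolding smooth_on_def by (intro allI, rule Ck_on_bilinear[OF _ bounded_bilinear_scaleR]) simp_all

lemma smooth_on_mult:
  fixes f g :: "'e::real_normed_vector \<Rightarrow> real"
  shows "open S \<Longrightarrow> smooth_on S f \<Longrightarrow> smooth_on S g \<Longrightarrow> smooth_on S (\<lambda>x. f x * g x)"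
  unfolding smooth_on_def by (intro allI, rule Ck_on_bilinear[OF _ bounded_bilinear_mult]) simp_all

lemma smooth_on_inner:
  "open S \<Longrightarrow> smooth_on S f \<Longrightarrow> smooth_on S g \<Longrightarrow> smooth_on S (\<lambda>x. f x \<bullet> g x)"
  unfolding smooth_on_def by (intro allI, rule Ck_on_bilinear[OF _ bounded_bilinear_inner]) simp_all

lemma smooth_on_compose:
  fixes f :: "'e::real_normed_vector \<Rightarrow> 'f::euclidean_space"
    and g :: "'f \<Rightarrow> 'g::real_normed_vector"
  shows "open S \<Longrightarrow> open T \<Longrightarrow> f ` S \<subseteq> T \<Longrightarrow> smooth_on S f \<Longrightarrow> smooth_on T g
    \<Longrightarrow> smooth_on S (g \<circ> f)"
  unfolding smooth_on_def by (intro allI, rule Ck_on_compose[of S T f]) simp_all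

section \<open>Symmetry of second derivatives\<close>

text \<open>The second difference of \<open>f\<close> over a small parallelogram is, by two applications of the mean
  value theorem, a value of the iterated derivative near \<open>x\<close>. As it does not depend on the order of
  the two directions, continuity yields the symmetry.\<close>

lemma second_difference_mean_value:
  fixes f :: "'e::real_normed_vector \<Rightarrow> real"
  assumes "Ck_on 2 (ball x r) f" "0 < s" "s * (norm u + norm v) < r"
  shows "\<exists>y. dist x y \<le> s * (norm u + norm v) \<and>
    f (x + s *\<^sub>R u + s *\<^sub>R v) - f (x + s *\<^sub>R u) - f (x + s *\<^sub>R v) + f x =
      s\<^sup>2 * frechet_derivative (\<lambda>z. frechet_derivative f (at z) u) (at y) v"
proof -
  define Df where "Df = (\<lambda>z. frechet_derivative f (at z) u)"
  have near: "norm (a *\<^sub>R u + b *\<^sub>R v) \<le> s * (norm u + norm v)"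
    if "0 \<le> a" "a \<le> s" "0 \<le> b" "b \<le> s" for a b
  proof -
    have "norm (a *\<^sub>R u + b *\<^sub>R v) \<le> a * norm u + b * norm v"
      using norm_triangle_ineq[of "a *\<^sub>R u" "b *\<^sub>R v"] that by simp
    also have "\<dots> \<le> s * norm u + s * norm v"
      using that by (intro add_mono mult_right_mono) auto
    finally show ?thesis by (simp add: distrib_left)
  qed
  have inb: "x + (a *\<^sub>R u + b *\<^sub>R v) \<in> ball x r"
    if "0 \<le> a" "a \<le> s" "0 \<le> b" "b \<le> s" for a b
    using near[OF that] assms(3) norm_minus_cancel[of "a *\<^sub>R u + b *\<^sub>R v"] by (simp add: dist_norm)
  have d1: "(f has_derivative frechet_derivative f (at z)) (at z)" if "z \<in> ball x r" for z
    by (rule frechet_derivative_works[THEN iffD1]) (use assms(1) that in \<open>auto simp: numeral_2_eq_2\<close>)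
  have d2: "(Df has_derivative frechet_derivative Df (at z)) (at z)" if "z \<in> ball x r" for z
    by (rule frechet_derivative_works[THEN iffD1])
       (use assms(1) that in \<open>auto simp: numeral_2_eq_2 Df_def\<close>)
  define h where "h = (\<lambda>a. f (x + (a *\<^sub>R u + s *\<^sub>R v)) - f (x + (a *\<^sub>R u + 0 *\<^sub>R v)))"
  have hd: "(h has_derivative
      (\<lambda>t. t * (Df (x + (a *\<^sub>R u + s *\<^sub>R v)) - Df (x + (a *\<^sub>R u + 0 *\<^sub>R v))))) (at a within {0..s})"
    if a: "0 \<le> a" "a \<le> s" for a
  proof -
    have *: "((\<lambda>a. f (x + (a *\<^sub>R u + b *\<^sub>R v))) has_derivative
        (\<lambda>t. t * Df (x + (a *\<^sub>R u + b *\<^sub>R v)))) (at a within {0..s})" if b: "0 \<le> b" "b \<le> s" for b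
    proof -
      interpret linear "frechet_derivative f (at (x + (a *\<^sub>R u + b *\<^sub>R v)))"
        using d1[OF inb[OF a b]] has_derivative_linear by blast
      have "((\<lambda>a. x + (a *\<^sub>R u + b *\<^sub>R v)) has_derivative (\<lambda>t. t *\<^sub>R u)) (at a within {0..s})"
        by (auto intro!: derivative_eq_intros)
      from diff_chain_within[OF this has_derivative_at_withinI[OF d1[OF inb[OF a b]]]]
      show ?thesis by (simp add: o_def Df_def scaleR)
    qed
    show ?thesis unfolding h_def right_diff_distrib
      by (intro has_derivative_diff *) (use assms(2) in auto)
  qed
  obtain a where a: "a \<in> {0..s}"
    and ha: "h s - h 0 = s * (Df (x + (a *\<^sub>R u + s *\<^sub>R v)) - Df (x + (a *\<^sub>R u + 0 *\<^sub>R v)))"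
    using mvt_very_simple[OF less_imp_le[OF assms(2)] hd] by auto
  have kd: "((\<lambda>b. Df (x + (a *\<^sub>R u + b *\<^sub>R v))) has_derivative
      (\<lambda>t. t * frechet_derivative Df (at (x + (a *\<^sub>R u + b *\<^sub>R v))) v)) (at b within {0..s})"
    if b: "0 \<le> b" "b \<le> s" for b
  proof -
    have z: "x + (a *\<^sub>R u + b *\<^sub>R v) \<in> ball x r" using a b by (intro inb) auto
    interpret linear "frechet_derivative Df (at (x + (a *\<^sub>R u + b *\<^sub>R v)))"
      using d2[OF z] has_derivative_linear by blast
    have "((\<lambda>b. x + (a *\<^sub>R u + b *\<^sub>R v)) has_derivative (\<lambda>t. t *\<^sub>R v)) (at b within {0..s})"
      by (auto intro!: derivative_eq_intros)
    from diff_chain_within[OF this has_derivative_at_withinI[OF d2[OF z]]]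
    show ?thesis by (simp add: o_def scaleR)
  qed
  obtain b where b: "b \<in> {0..s}"
    and kb: "Df (x + (a *\<^sub>R u + s *\<^sub>R v)) - Df (x + (a *\<^sub>R u + 0 *\<^sub>R v)) =
      s * frechet_derivative Df (at (x + (a *\<^sub>R u + b *\<^sub>R v))) v"
    using mvt_very_simple[OF less_imp_le[OF assms(2)] kd] by auto
  have "f (x + s *\<^sub>R u + s *\<^sub>R v) - f (x + s *\<^sub>R u) - f (x + s *\<^sub>R v) + f x = h s - h 0"
    by (simp add: h_def algebra_simps)
  also have "\<dots> = s\<^sup>2 * frechet_derivative Df (at (x + (a *\<^sub>R u + b *\<^sub>R v))) v"
    unfolding ha kb by (simp add: power2_eq_square)
  finally show ?thesis unfolding Df_def
    using near[of a b] a b norm_minus_cancel[of "a *\<^sub>R u + b *\<^sub>R v"]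
    by (intro exI[of _ "x + (a *\<^sub>R u + b *\<^sub>R v)"]) (simp add: dist_norm del: norm_minus_cancel)
qed

lemma second_derivative_symmetric_real:
  fixes f :: "'e::real_normed_vector \<Rightarrow> real"
  assumes "open S" "x \<in> S" "smooth_on S f"
  shows "frechet_derivative (\<lambda>z. frechet_derivative f (at z) u) (at x) v =
         frechet_derivative (\<lambda>z. frechet_derivative f (at z) v) (at x) u"
proof -
  let ?D = "\<lambda>u v y. frechet_derivative (\<lambda>z. frechet_derivative f (at z) u) (at y) v"
  obtain r where r: "r > 0" "ball x r \<subseteq> S" using assms(1,2) openE by blast
  have C: "Ck_on 2 (ball x r) f" using assms(3) r Ck_on_subset unfolding smooth_on_def by blast
  \<comment> \<open>The side lengths \<open>s n\<close> tend to \<open>0\<close> and keep the parallelograms within the ball.\<close>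
  define s where "s = (\<lambda>n. r / (norm u + norm v + 1) / real (n + 2))"
  have N: "norm u + norm v + 1 > 0"
    using norm_ge_zero[of u] norm_ge_zero[of v] by linarith
  have s0: "s n > 0" for n unfolding s_def using r(1) N by (intro divide_pos_pos) auto
  have "s n * (norm u + norm v) < r" for n
  proof -
    have "s n * (norm u + norm v) = r * ((norm u + norm v) / ((norm u + norm v + 1) * real (n+2)))"
      by (simp add: s_def)
    also have "\<dots> < r * 1"
    proof (rule mult_strict_left_mono[OF _ r(1)])
      have "norm u + norm v < (norm u + norm v + 1) * 1" by simp
      also have "\<dots> \<le> (norm u + norm v + 1) * real (n+2)" by (intro mult_left_mono) auto
      finally have less: "norm u + norm v < (norm u + norm v + 1) * real (n+2)" .
      then have "0 < (norm u + norm v + 1) * real (n+2)"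
        by (rule le_less_trans[rotated]) simp
      then show "(norm u + norm v) / ((norm u + norm v + 1) * real (n+2)) < 1"
        using less by (subst divide_less_eq_1_pos)
    qed
    finally show ?thesis by simp
  qed
  note sr = this
  have slim: "(\<lambda>n. s n * (norm u + norm v)) \<longlonglongrightarrow> 0"
  proof -
    have "(\<lambda>n. inverse (real (Suc n))) \<longlonglongrightarrow> 0" by (rule LIMSEQ_inverse_real_of_nat)
    then have "(\<lambda>n. inverse (real (Suc (Suc n)))) \<longlonglongrightarrow> 0" by (rule LIMSEQ_Suc)
    then have "(\<lambda>n. (r / (norm u + norm v + 1) * (norm u + norm v)) * inverse (real (Suc (Suc n)))) \<longlonglongrightarrow> 0"
      by (rule tendsto_mult_right_zero)
    then show ?thesis by (simp add: s_def field_simps)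
  qed
  have ex1: "\<forall>n. \<exists>y. dist x y \<le> s n * (norm u + norm v) \<and>
    f (x + s n *\<^sub>R u + s n *\<^sub>R v) - f (x + s n *\<^sub>R u) - f (x + s n *\<^sub>R v) + f x = (s n)\<^sup>2 * ?D u v y"
    using second_difference_mean_value[OF C s0 sr] by blast
  have ex2: "\<forall>n. \<exists>y. dist x y \<le> s n * (norm v + norm u) \<and>
    f (x + s n *\<^sub>R v + s n *\<^sub>R u) - f (x + s n *\<^sub>R v) - f (x + s n *\<^sub>R u) + f x = (s n)\<^sup>2 * ?D v u y"
    using second_difference_mean_value[OF C s0, of _ v u] sr by (simp add: add.commute)
  obtain y where y: "\<And>n. dist x (y n) \<le> s n * (norm u + norm v)"
    "\<And>n. f (x + s n *\<^sub>R u + s n *\<^sub>R v) - f (x + s n *\<^sub>R u) - f (x + s n *\<^sub>R v) + f x = (s n)\<^sup>2 * ?D u v (y n)"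
    using choice[OF ex1] by blast
  obtain z where z: "\<And>n. dist x (z n) \<le> s n * (norm v + norm u)"
    "\<And>n. f (x + s n *\<^sub>R v + s n *\<^sub>R u) - f (x + s n *\<^sub>R v) - f (x + s n *\<^sub>R u) + f x = (s n)\<^sup>2 * ?D v u (z n)"
    using choice[OF ex2] by blast
  have "(s n)\<^sup>2 * ?D u v (y n) = (s n)\<^sup>2 * ?D v u (z n)" for n
    unfolding y(2)[symmetric] z(2)[symmetric] by (simp add: algebra_simps)
  then have eq: "?D u v (y n) = ?D v u (z n)" for n using s0[of n] by (metis less_irrefl mult_cancel_left zero_less_power2)
  have cont: "isCont (?D u v) x" for u v
    using smooth_on_imp_continuous_on[OF smooth_on_derivative[OF smooth_on_derivative[OF assms(3)]]]
      assms(1,2) continuous_on_eq_continuous_at by blast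
  have lim: "w \<longlonglongrightarrow> x" if "\<And>n. dist x (w n) \<le> s n * (norm u + norm v)" for w
    by (rule metric_tendsto_imp_tendsto[OF slim])
       (use that s0 in \<open>auto simp: dist_commute dist_norm mult_nonneg_nonneg less_imp_le\<close>)
  have "(\<lambda>n. ?D u v (y n)) \<longlonglongrightarrow> ?D u v x"
    by (rule isCont_tendsto_compose[OF cont lim]) (rule y(1))
  moreover have "(\<lambda>n. ?D v u (z n)) \<longlonglongrightarrow> ?D v u x"
    by (rule isCont_tendsto_compose[OF cont lim]) (use z(1) in \<open>simp add: add.commute\<close>)
  ultimately show ?thesis unfolding eq using LIMSEQ_unique by blast
qed

lemma frechet_derivative_inner_left:
  "f differentiable (at x) \<Longrightarrow>
    frechet_derivative (\<lambda>x. f x \<bullet> b) (at x) v = frechet_derivative f (at x) v \<bullet> b"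
  using frechet_derivative_at[OF has_derivative_inner_left, of f "frechet_derivative f (at x)" x b]
  by (metis frechet_derivative_works)

lemma second_derivative_symmetric:
  fixes f :: "'e::real_normed_vector \<Rightarrow> 'f::euclidean_space"
  assumes "open S" "x \<in> S" "smooth_on S f"
  shows "frechet_derivative (\<lambda>z. frechet_derivative f (at z) u) (at x) v =
         frechet_derivative (\<lambda>z. frechet_derivative f (at z) v) (at x) u"
proof (rule euclidean_eqI)
  fix b :: 'f assume "b \<in> Basis"
  have sb: "smooth_on S (\<lambda>x. f x \<bullet> b)"
    by (rule smooth_on_bounded_linear_comp[OF assms(1) bounded_linear_inner_left assms(3)])
  have "frechet_derivative (\<lambda>z. frechet_derivative f (at z) u) (at x) v \<bullet> b =
      frechet_derivative (\<lambda>z. frechet_derivative (\<lambda>x. f x \<bullet> b) (at z) u) (at x) v" for u v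
  proof -
    have "frechet_derivative (\<lambda>z. frechet_derivative f (at z) u) (at x) v \<bullet> b =
      frechet_derivative (\<lambda>z. frechet_derivative f (at z) u \<bullet> b) (at x) v"
      using smooth_on_imp_differentiable[OF smooth_on_derivative[OF assms(3)] assms(2)]
      by (simp add: frechet_derivative_inner_left)
    also have "frechet_derivative (\<lambda>z. frechet_derivative f (at z) u \<bullet> b) (at x) =
      frechet_derivative (\<lambda>z. frechet_derivative (\<lambda>x. f x \<bullet> b) (at z) u) (at x)"
    proof (rule frechet_derivative_transform_within_open[OF _ assms(1,2)])
      show "(\<lambda>z. frechet_derivative f (at z) u \<bullet> b) differentiable at x"
        using smooth_on_imp_differentiable[OF smooth_on_bounded_linear_comp[OF assms(1)
          bounded_linear_inner_left smooth_on_derivative[OF assms(3)]] assms(2)] .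
    qed (simp add: frechet_derivative_inner_left smooth_on_imp_differentiable[OF assms(3)])
    finally show ?thesis .
  qed
  then show "frechet_derivative (\<lambda>z. frechet_derivative f (at z) u) (at x) v \<bullet> b =
      frechet_derivative (\<lambda>z. frechet_derivative f (at z) v) (at x) u \<bullet> b"
    using second_derivative_symmetric_real[OF assms(1,2) sb] by simp
qed

section \<open>Solutions of linear systems with smooth coefficients\<close>

text \<open>Near \<open>x\<close> the maps \<open>L y\<close> differ from the injective \<open>L x\<close> by less, in operator norm, than half of a lower
  bound of \<open>L x\<close>. The bound obtained is uniform in \<open>y\<close> and replaces the continuity of the inverse.\<close>

lemma linear_family_bounded_below:
  fixes L :: "'e::real_normed_vector \<Rightarrow> 'f::euclidean_space \<Rightarrow> 'f"
  assumes "open S" "x \<in> S" "\<And>y. y \<in> S \<Longrightarrow> linear (L y)" "inj (L x)"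
    and "\<And>v. isCont (\<lambda>y. L y v) x"
  shows "\<exists>m>0. \<forall>\<^sub>F y in at x. \<forall>z. m * norm z \<le> norm (L y z)"
proof -
  obtain m where m: "m > 0" "\<And>z. m * norm z \<le> norm (L x z)"
    using linear_inj_bounded_below_pos[OF assms(3)[OF assms(2)] assms(4)] by metis
  define \<epsilon> where "\<epsilon> = (\<lambda>y. \<Sum>i\<in>Basis. norm (L y i - L x i))"
  have "((\<lambda>y. \<epsilon> y) \<longlongrightarrow> (\<Sum>i\<in>Basis. norm (L x i - L x i))) (at x)"
    unfolding \<epsilon>_def using assms(5) by (intro tendsto_intros) (simp add: isCont_def)
  then have "(\<epsilon> \<longlongrightarrow> 0) (at x)" by simp
  then have "\<forall>\<^sub>F y in at x. \<epsilon> y < m / 2" using m(1) by (intro order_tendstoD(2)) auto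
  moreover have "\<forall>\<^sub>F y in at x. y \<in> S" using assms(1,2) by (simp add: eventually_at_in_open')
  ultimately have "\<forall>\<^sub>F y in at x. \<forall>z. (m / 2) * norm z \<le> norm (L y z)"
  proof eventually_elim
    case (elim y)
    show ?case
    proof
      fix z
      have expand: "L w z = (\<Sum>i\<in>Basis. (z \<bullet> i) *\<^sub>R L w i)" if "w \<in> S" for w
        using assms(3)[OF that] by (rule linear_sum_Basis)

      have "norm (L y z - L x z) = norm (\<Sum>i\<in>Basis. (z \<bullet> i) *\<^sub>R (L y i - L x i))"
        by (simp add: expand[OF elim(2)] expand[OF assms(2)] sum_subtractf scaleR_diff_right)
      also have "\<dots> \<le> (\<Sum>i\<in>Basis. norm z * norm (L y i - L x i))"
        by (rule sum_norm_le) (auto intro!: mult_right_mono Basis_le_norm)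
      also have "\<dots> = norm z * \<epsilon> y" by (simp add: \<epsilon>_def sum_distrib_left)
      also have "\<dots> \<le> norm z * (m / 2)" using elim(1) by (intro mult_left_mono) auto
      finally have "norm (L y z - L x z) \<le> m / 2 * norm z" by (simp add: mult.commute)
      moreover have "norm (L x z) \<le> norm (L y z) + norm (L y z - L x z)"
        by (metis norm_triangle_sub norm_minus_commute)
      ultimately show "m / 2 * norm z \<le> norm (L y z)" using m(2)[of z] by linarith
    qed
  qed
  then show ?thesis using m(1) by (intro exI[of _ "m/2"]) auto
qed

lemma isCont_linear_solution:
  fixes L :: "'e::real_normed_vector \<Rightarrow> 'f::euclidean_space \<Rightarrow> 'f"
  assumes "open S" "x \<in> S" "\<And>y. y \<in> S \<Longrightarrow> linear (L y)" "inj (L x)"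
    and "\<And>v. isCont (\<lambda>y. L y v) x" "isCont b x"
    and "\<And>y. y \<in> S \<Longrightarrow> L y (V y) = b y"
  shows "isCont V x"
proof -
  obtain m where m: "m > 0" "\<forall>\<^sub>F y in at x. \<forall>z. m * norm z \<le> norm (L y z)"
    using linear_family_bounded_below[OF assms(1-5)] by blast
  have "((\<lambda>y. norm (b y - L y (V x)) / m) \<longlongrightarrow> norm (b x - L x (V x)) / m) (at x)"
    using assms(5)[of "V x"] assms(6) m(1) by (intro tendsto_intros) (auto simp: isCont_def)
  then have lim: "((\<lambda>y. norm (b y - L y (V x)) / m) \<longlongrightarrow> 0) (at x)"
    using assms(7)[OF assms(2)] by simp
  have "\<forall>\<^sub>F y in at x. y \<in> S" using assms(1,2) by (simp add: eventually_at_in_open')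
  with m(2) have "\<forall>\<^sub>F y in at x. norm (V y - V x) \<le> norm (b y - L y (V x)) / m"
  proof eventually_elim
    case (elim y)
    have "m * norm (V y - V x) \<le> norm (L y (V y - V x))" using elim by blast
    also have "L y (V y - V x) = b y - L y (V x)"
      using assms(3)[OF elim(2)] assms(7)[OF elim(2)] by (simp add: linear_diff)
    finally show ?case using m(1) by (simp add: field_simps)
  qed
  then have "((\<lambda>y. V y - V x) \<longlongrightarrow> 0) (at x)"
    by (rule Lim_null_comparison[OF _ lim])
  then show ?thesis by (simp add: isCont_def LIM_zero_iff)
qed

text \<open>Only one factor is differentiable: it is \<open>O(y - x)\<close>, and the other one, being \<open>o(1)\<close>, makes the
  product \<open>o(y - x)\<close>.\<close>

lemma has_derivative_zero_product:
  fixes c :: "'e::real_normed_vector \<Rightarrow> real" and w :: "'e \<Rightarrow> 'f::real_normed_vector"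
  assumes "isCont c x" "c x = 0" "(w has_derivative w') (at x)" "w x = 0"
  shows "((\<lambda>y. c y *\<^sub>R w y) has_derivative (\<lambda>_. 0)) (at x)"
  unfolding has_derivative_at_alt
proof (intro conjI allI impI)
  show "bounded_linear (\<lambda>_. 0)" by simp
  fix e :: real assume e: "e > 0"
  have bl: "bounded_linear w'" using assms(3) has_derivative_bounded_linear by blast
  define B where "B = onorm w' + 1"
  have B: "B > 0" using onorm_pos_le[OF bl] by (simp add: B_def)
  obtain d1 where d1: "d1 > 0" "\<And>y. norm (y - x) < d1 \<Longrightarrow> norm (w y - w x - w' (y - x)) \<le> 1 * norm (y - x)"
    using assms(3) unfolding has_derivative_at_alt by (meson zero_less_one)
  have "e / B > 0" using e B by simp
  then obtain d2 where d2: "d2 > 0" "\<And>y. norm (y - x) < d2 \<Longrightarrow> norm (c y - c x) < e / B"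
    using assms(1) unfolding continuous_at_eps_delta dist_norm by (metis dist_norm)
  have "norm (c y *\<^sub>R w y - c x *\<^sub>R w x - 0) \<le> e * norm (y - x)" if y: "norm (y - x) < min d1 d2" for y
  proof -
    have "norm (w y) \<le> norm (w' (y - x)) + norm (w y - w x - w' (y - x))"
      using assms(4) by (metis diff_zero norm_triangle_sub)
    also have "\<dots> \<le> onorm w' * norm (y - x) + 1 * norm (y - x)"
      using d1(2)[of y] y onorm[OF bl, of "y - x"] by (intro add_mono) auto
    finally have w: "norm (w y) \<le> B * norm (y - x)" by (simp add: B_def algebra_simps)
    have "\<bar>c y\<bar> \<le> e / B" using d2(2)[of y] y assms(2) by simp
    then have "\<bar>c y\<bar> * norm (w y) \<le> (e / B) * (B * norm (y - x))"
      by (intro mult_mono w) (use e B in auto)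
    then show ?thesis using B assms(2) by simp
  qed
  then show "\<exists>d>0. \<forall>y. norm (y - x) < d \<longrightarrow> norm (c y *\<^sub>R w y - c x *\<^sub>R w x - 0) \<le> e * norm (y - x)"
    using d1(1) d2(1) by (intro exI[of _ "min d1 d2"]) auto
qed

text \<open>The equation that the derivative of \<open>V\<close> satisfies is the formally differentiated system. It has
  the same matrix \<open>L\<close>, which permits an induction on the order of differentiability.\<close>

lemma has_derivative_linear_solution:
  fixes L :: "'e::real_normed_vector \<Rightarrow> 'f::euclidean_space \<Rightarrow> 'f"
  assumes "open S" "x \<in> S" "\<And>y. y \<in> S \<Longrightarrow> linear (L y)" "inj (L x)"
    and L: "\<And>v. ((\<lambda>y. L y v) has_derivative L' v) (at x)"
    and b: "(b has_derivative b') (at x)"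
    and sol: "\<And>y. y \<in> S \<Longrightarrow> L y (V y) = b y"
  shows "V differentiable (at x)"
    and "L x (frechet_derivative V (at x) h) = b' h - (\<Sum>i\<in>Basis. (V x \<bullet> i) *\<^sub>R L' i h)"
proof -
  interpret Lx: linear "L x" using assms(2,3) by blast
  obtain g where g: "linear g" "g \<circ> L x = id"
    using linear_injective_left_inverse[OF Lx.linear_axioms assms(4)] by blast
  have gL: "g (L x z) = z" for z using g(2) by (metis comp_apply id_apply)
  have Lg: "L x (g z) = z" for z
    using linear_inj_imp_surj[OF Lx.linear_axioms assms(4)] gL by (metis surjD)
  have contV: "isCont V x"
    by (rule isCont_linear_solution[where b = b and L = L and V = V, OF assms(1-4)])
       (use L b sol has_derivative_continuous in blast)+
  have expand: "L w z = (\<Sum>i\<in>Basis. (z \<bullet> i) *\<^sub>R L w i)" if "w \<in> S" for w z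
    using assms(3)[OF that] by (rule linear_sum_Basis)
  \<comment> \<open>\<open>r y\<close> is \<open>L x (V y - V x)\<close>, with \<open>L x\<close> written as \<open>L y - (L y - L x)\<close>: the last summand has zero
      derivative because \<open>V y - V x\<close> tends to \<open>0\<close> and \<open>L y - L x\<close> is differentiable.\<close>
  define r where "r = (\<lambda>y. b y - (\<Sum>i\<in>Basis. (V x \<bullet> i) *\<^sub>R L y i)
      - (\<Sum>i\<in>Basis. ((V y - V x) \<bullet> i) *\<^sub>R (L y i - L x i)))"
  have Vr: "V y = V x + g (r y)" if "y \<in> S" for y
  proof -
    have "L x (V y - V x) = L y (V y) - L y (V x) - (L y (V y - V x) - L x (V y - V x))"
      using assms(3)[OF that] by (simp add: linear_diff)
    also have "\<dots> = r y"
      unfolding r_def sol[OF that] expand[OF that, of "V x"] expand[OF that, of "V y - V x"]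
        expand[OF assms(2), of "V y - V x"]
      by (simp add: sum_subtractf scaleR_diff_right)
    finally show ?thesis using gL by (metis add_diff_cancel_left' add.commute diff_add_cancel)
  qed
  have "((\<lambda>y. \<Sum>i\<in>Basis. ((V y - V x) \<bullet> i) *\<^sub>R (L y i - L x i)) has_derivative (\<lambda>h. \<Sum>i\<in>(Basis::'f set). 0)) (at x)"
  proof (intro has_derivative_sum has_derivative_zero_product)
    fix i
    show "isCont (\<lambda>y. (V y - V x) \<bullet> i) x" using contV by (intro continuous_intros)
    show "((\<lambda>y. L y i - L x i) has_derivative (\<lambda>h. L' i h - 0)) (at x)"
      by (intro has_derivative_diff L has_derivative_const)
  qed auto
  then have "(r has_derivative (\<lambda>h. b' h - (\<Sum>i\<in>Basis. (V x \<bullet> i) *\<^sub>R L' i h) - (\<Sum>i\<in>(Basis::'f set). 0))) (at x)"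
    unfolding r_def
    by (rule has_derivative_diff[OF has_derivative_diff[OF b
          has_derivative_sum[OF has_derivative_scaleR_right[OF L]]]])
  then have "(r has_derivative (\<lambda>h. b' h - (\<Sum>i\<in>Basis. (V x \<bullet> i) *\<^sub>R L' i h))) (at x)" by simp
  from bounded_linear.has_derivative[OF linear_conv_bounded_linear[THEN iffD1, OF g(1)] this]
  have "((\<lambda>y. V x + g (r y)) has_derivative
      (\<lambda>h. 0 + g (b' h - (\<Sum>i\<in>Basis. (V x \<bullet> i) *\<^sub>R L' i h)))) (at x)"
    by (intro has_derivative_add has_derivative_const)
  then have D: "(V has_derivative (\<lambda>h. g (b' h - (\<Sum>i\<in>Basis. (V x \<bullet> i) *\<^sub>R L' i h)))) (at x)"
    using has_derivative_transform_within_open[OF _ assms(1,2) Vr[symmetric]] by simp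
  then show "V differentiable (at x)" by (auto simp: differentiable_def)
  show "L x (frechet_derivative V (at x) h) = b' h - (\<Sum>i\<in>Basis. (V x \<bullet> i) *\<^sub>R L' i h)"
    unfolding frechet_derivative_at[OF D, symmetric] by (rule Lg)
qed

text \<open>Each directional derivative of \<open>V\<close> solves a system with the same \<open>L\<close>. Its right-hand side contains
  \<open>V\<close> itself only undifferentiated, so the induction hypothesis applies first to \<open>V\<close> and then to its
  derivatives.\<close>

lemma Ck_on_linear_solution:
  fixes L :: "'e::real_normed_vector \<Rightarrow> 'f::euclidean_space \<Rightarrow> 'f"
  assumes S: "open S" and lin: "\<And>y. y \<in> S \<Longrightarrow> linear (L y)" and inj: "\<And>y. y \<in> S \<Longrightarrow> inj (L y)"
    and L: "\<And>v. smooth_on S (\<lambda>y. L y v)"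
    and "Ck_on k S b" "\<And>y. y \<in> S \<Longrightarrow> L y (V y) = b y"
  shows "Ck_on k S V"
  using assms(5,6)
proof (induction k arbitrary: b V)
  case 0
  have "isCont V x" if x: "x \<in> S" for x
  proof (rule isCont_linear_solution[where b = b and L = L and V = V, OF S x lin inj[OF x]])
    show "isCont (\<lambda>y. L y v) x" for v
      using smooth_on_imp_continuous_on[OF L] S x continuous_on_eq_continuous_at by blast
    show "isCont b x" using 0(1) S x continuous_on_eq_continuous_at by auto
    show "L y (V y) = b y" if "y \<in> S" for y using 0(2) that .
  qed
  then show ?case by (simp add: continuous_at_imp_continuous_on)
next
  case (Suc k)
  let ?D = "\<lambda>f. \<lambda>x. frechet_derivative f (at x)"
  have bd: "(b has_derivative ?D b x) (at x)" if "x \<in> S" for x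
    using Suc.prems that by (simp flip: frechet_derivative_works)
  note sol = has_derivative_linear_solution[OF S _ lin inj
      smooth_on_imp_has_derivative[OF L] bd Suc.prems(2)]
  have V: "Ck_on k S V" using Suc.IH[OF Ck_on_Suc_imp[OF Suc.prems(1)] Suc.prems(2)] .
  have "Ck_on k S (\<lambda>x. ?D V x h)" for h
  proof (rule Suc.IH)
    show "L y (?D V y h) = ?D b y h - (\<Sum>i\<in>Basis. (V y \<bullet> i) *\<^sub>R ?D (\<lambda>y. L y i) y h)" if "y \<in> S" for y
      by (rule sol(2)) (use that in auto)
    have "Ck_on k S (\<lambda>y. ?D b y h + (\<Sum>i\<in>Basis. (- V y \<bullet> i) *\<^sub>R ?D (\<lambda>y. L y i) y h))"
    proof (intro Ck_on_add Ck_on_sum S)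
      show "Ck_on k S (\<lambda>y. ?D b y h)" using Suc.prems(1) by simp
      show "Ck_on k S (\<lambda>y. (- V y \<bullet> i) *\<^sub>R ?D (\<lambda>y. L y i) y h)" for i
      proof (rule Ck_on_bilinear[OF S bounded_bilinear_scaleR])
        show "Ck_on k S (\<lambda>y. - V y \<bullet> i)"
          by (rule Ck_on_bounded_linear_comp[OF S _ V])
             (intro bounded_linear_compose[OF bounded_linear_inner_left] bounded_linear_minus bounded_linear_ident)
        show "Ck_on k S (\<lambda>y. ?D (\<lambda>y. L y i) y h)"
          using smooth_on_derivative[OF L] unfolding smooth_on_def by blast
      qed
    qed
    then show "Ck_on k S (\<lambda>y. ?D b y h - (\<Sum>i\<in>Basis. (V y \<bullet> i) *\<^sub>R ?D (\<lambda>y. L y i) y h))"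
      by (simp add: sum_negf)
  qed
  moreover have "V differentiable (at x)" if "x \<in> S" for x
    by (rule sol(1)) (use that in auto)
  ultimately show ?case by simp
qed

lemma smooth_on_linear_solution:
  fixes L :: "'e::real_normed_vector \<Rightarrow> 'f::euclidean_space \<Rightarrow> 'f"
  assumes "open S" "\<And>y. y \<in> S \<Longrightarrow> linear (L y)" "\<And>y. y \<in> S \<Longrightarrow> inj (L y)"
    and "\<And>v. smooth_on S (\<lambda>y. L y v)" "smooth_on S b" "\<And>y. y \<in> S \<Longrightarrow> L y (V y) = b y"
  shows "smooth_on S V"
  unfolding smooth_on_def
proof
  fix k
  have "Ck_on k S b" using assms(5) unfolding smooth_on_def by blast
  from Ck_on_linear_solution[OF assms(1-4) this assms(6)] show "Ck_on k S V" .
qed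

section \<open>Bump functions\<close>

text \<open>The flat function \<open>exp (- 1 / t)\<close>, together with its multiples by powers of \<open>1 / t\<close>: the span of
  this family is closed under differentiation, which gives smoothness of all of them at once.\<close>

definition flat_exp :: "nat \<Rightarrow> real \<Rightarrow> real" where
  "flat_exp n t = (if t \<le> 0 then 0 else inverse t ^ n * exp (- inverse t))"

lemma flat_exp_has_derivative:
  "(flat_exp n has_real_derivative (flat_exp (n + 2) t - real n * flat_exp (n + 1) t)) (at t)"
proof -
  consider "t > 0" | "t < 0" | "t = 0" by linarith
  then show ?thesis
  proof cases
    case 1
    have "((\<lambda>t. inverse t ^ n * exp (- inverse t)) has_real_derivative
        inverse t ^ n * (exp (- inverse t) * (inverse t * inverse t)) +
        real n * inverse t ^ (n - 1) * (- (inverse t * inverse t)) * exp (- inverse t)) (at t)"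
      using 1 by (auto intro!: derivative_eq_intros)
    also have "inverse t ^ n * (exp (- inverse t) * (inverse t * inverse t)) +
        real n * inverse t ^ (n - 1) * (- (inverse t * inverse t)) * exp (- inverse t) =
        flat_exp (n + 2) t - real n * flat_exp (n + 1) t"
      using 1 by (cases n) (simp_all add: flat_exp_def)
    finally have "((\<lambda>t. inverse t ^ n * exp (- inverse t)) has_real_derivative
        (flat_exp (n + 2) t - real n * flat_exp (n + 1) t)) (at t)" .
    then show ?thesis
      by (rule has_field_derivative_transform_within_open[where S = "{0<..}"])
         (use 1 in \<open>auto simp: flat_exp_def\<close>)
  next
    case 2
    have "((\<lambda>t. 0) has_real_derivative 0) (at t)" by simp
    then have "(flat_exp n has_real_derivative 0) (at t)"
      by (rule has_field_derivative_transform_within_open[where S = "{..<0}"])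
         (use 2 in \<open>auto simp: flat_exp_def\<close>)
    then show ?thesis using 2 by (simp add: flat_exp_def)
  next
    case 3
    \<comment> \<open>Right of \<open>0\<close>, the difference quotient is this function of \<open>u = 1 / h\<close>.\<close>
    have "((\<lambda>u::real. u ^ (n + 1) / exp u) \<longlongrightarrow> 0) at_top" by (rule tendsto_power_div_exp_0)
    then have "((\<lambda>h::real. inverse h ^ (n + 1) / exp (inverse h)) \<longlongrightarrow> 0) (at_right 0)"
      by (rule filterlim_compose[OF _ filterlim_inverse_at_top_right])
    then have "((\<lambda>h. (flat_exp n (0 + h) - flat_exp n 0) / h) \<longlongrightarrow> 0) (at_right 0)"
      by (rule Lim_transform_eventually)
         (auto simp: flat_exp_def eventually_at_right_field exp_minus field_simps intro!: exI[of _ 1])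
    moreover have "((\<lambda>h. (flat_exp n (0 + h) - flat_exp n 0) / h) \<longlongrightarrow> 0) (at_left 0)"
      by (rule Lim_transform_eventually[OF tendsto_const])
         (auto simp: flat_exp_def eventually_at_left_field intro!: exI[of _ "-1"])
    ultimately have "(flat_exp n has_real_derivative 0) (at 0)"
      unfolding DERIV_def by (rule filterlim_split_at[rotated])
    then show ?thesis using 3 by (simp add: flat_exp_def)
  qed
qed

lemma smooth_on_flat_exp: "smooth_on UNIV (flat_exp n)"
  unfolding smooth_on_def
proof
  fix k show "Ck_on k UNIV (flat_exp n)"
  proof (induction k arbitrary: n)
    case 0
    show ?case
      using DERIV_isCont[OF flat_exp_has_derivative] by (simp add: continuous_at_imp_continuous_on)
  next
    case (Suc k)
    show ?case
    proof (rule Ck_on_SucI)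
      show "(flat_exp n has_derivative
          (\<lambda>v. flat_exp (n + 2) t * v + (- real n * v) * flat_exp (n + 1) t)) (at t)" for t
        using flat_exp_has_derivative[of n t] unfolding has_field_derivative_def
        by (rule has_derivative_eq_rhs) (auto simp: algebra_simps)
      show "Ck_on k UNIV (\<lambda>t. flat_exp (n + 2) t * v + (- real n * v) * flat_exp (n + 1) t)" for v
        by (intro Ck_on_add Ck_on_bilinear[OF _ bounded_bilinear_mult] Ck_on_const Suc) auto
    qed auto
  qed
qed

lemma smooth_bump_exists:
  fixes x0 :: "'e::euclidean_space"
  assumes "open U" "x0 \<in> U"
  obtains \<phi> :: "'e \<Rightarrow> real" and K where "smooth_on UNIV \<phi>" "\<phi> x0 = 1" "compact K" "K \<subseteq> U"
    "\<And>x. x \<notin> K \<Longrightarrow> \<phi> x = 0"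
proof -
  obtain r where r: "r > 0" "cball x0 r \<subseteq> U" using assms open_contains_cball by blast
  define \<phi> where "\<phi> = (\<lambda>x. inverse (flat_exp 0 (r\<^sup>2)) * (flat_exp 0 \<circ> (\<lambda>x. r\<^sup>2 - (x - x0) \<bullet> (x - x0))) x)"
  have "smooth_on UNIV \<phi>" unfolding \<phi>_def
    by (intro smooth_on_mult smooth_on_const smooth_on_compose[OF _ _ _ _ smooth_on_flat_exp]
        smooth_on_diff smooth_on_inner smooth_on_ident) auto
  moreover have "\<phi> x0 = 1" using r(1) by (simp add: \<phi>_def flat_exp_def)
  moreover have "\<phi> x = 0" if "x \<notin> cball x0 r" for x
  proof -
    have "r < norm (x - x0)" using that by (simp add: dist_norm norm_minus_commute)
    then have "r\<^sup>2 \<le> (norm (x - x0))\<^sup>2" using r(1) by (intro power_mono) auto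
    then show ?thesis by (simp add: \<phi>_def flat_exp_def power2_norm_eq_inner)
  qed
  ultimately show thesis using that[of \<phi> "cball x0 r"] r(2) by auto
qed

section \<open>Wedge products and non-degeneracy\<close>

text \<open>As \<open>k\<close>-forms are functions of infinite sequences, independence of the members beyond the first \<open>k\<close>
  is part of the notion.\<close>

definition multilinear :: "nat \<Rightarrow> ((nat \<Rightarrow> 'v::real_vector) \<Rightarrow> real) \<Rightarrow> bool" where
  "multilinear k \<omega> \<longleftrightarrow>
     (\<forall>v w. (\<forall>i<k. v i = w i) \<longrightarrow> \<omega> v = \<omega> w) \<and> (\<forall>v. \<forall>i<k. linear (\<lambda>x. \<omega> (v(i := x))))"

lemma multilinear_cong:
  "multilinear k \<omega> \<Longrightarrow> (\<And>i. i < k \<Longrightarrow> v i = w i) \<Longrightarrow> \<omega> v = \<omega> w"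
  by (simp add: multilinear_def)

lemma multilinear_linear: "multilinear k \<omega> \<Longrightarrow> i < k \<Longrightarrow> linear (\<lambda>x. \<omega> (v(i := x)))"
  by (simp add: multilinear_def)

lemma wedge_cong:
  assumes "\<And>v w. (\<And>i. i < k \<Longrightarrow> v i = w i) \<Longrightarrow> \<omega> v = \<omega> w"
    and "\<And>v w. (\<And>i. i < l \<Longrightarrow> v i = w i) \<Longrightarrow> \<eta> v = \<eta> w"
    and "\<And>i. i < k + l \<Longrightarrow> v i = w i"
  shows "wedge k l \<omega> \<eta> v = wedge k l \<omega> \<eta> w"
proof -
  have "\<omega> (\<lambda>i. v (\<sigma> i)) = \<omega> (\<lambda>i. w (\<sigma> i))" "\<eta> (\<lambda>i. v (\<sigma> (k + i))) = \<eta> (\<lambda>i. w (\<sigma> (k + i)))"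
    if "\<sigma> permutes {..<k + l}" for \<sigma>
  proof -
    have "\<sigma> i < k + l" if "i < k + l" for i
      using permutes_in_image[OF \<open>\<sigma> permutes _\<close>] that by simp
    then show "\<omega> (\<lambda>i. v (\<sigma> i)) = \<omega> (\<lambda>i. w (\<sigma> i))"
      "\<eta> (\<lambda>i. v (\<sigma> (k + i))) = \<eta> (\<lambda>i. w (\<sigma> (k + i)))"
      by (auto intro!: assms)
  qed
  then show ?thesis unfolding wedge_def by (auto intro!: arg_cong2[where f = divide] sum.cong)
qed

text \<open>Composition with the transposition of \<open>i\<close> and \<open>j\<close> permutes the summands and flips their signs, but
  does not change \<open>v\<close>.\<close>

lemma wedge_alternating:
  assumes "i < k + l" "j < k + l" "i \<noteq> j" "v i = v j"
  shows "wedge k l \<omega> \<eta> v = 0"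
proof -
  let ?\<tau> = "Transposition.transpose i j"
  have p: "?\<tau> permutes {..<k + l}" using assms by (intro permutes_swap_id) auto
  have v: "v (?\<tau> m) = v m" for m using assms(4) by (auto simp: Transposition.transpose_def)
  let ?f = "\<lambda>\<sigma>. of_int (sign \<sigma>) * \<omega> (\<lambda>i. v (\<sigma> i)) * \<eta> (\<lambda>i. v (\<sigma> (k + i)))"
  have "sum ?f {\<sigma>. \<sigma> permutes {..<k + l}} = sum (\<lambda>\<sigma>. ?f (?\<tau> \<circ> \<sigma>)) {\<sigma>. \<sigma> permutes {..<k + l}}"
    by (rule setum_permutations_compose_left[OF p])
  also have "\<dots> = sum (\<lambda>\<sigma>. - ?f \<sigma>) {\<sigma>. \<sigma> permutes {..<k + l}}"
  proof (rule sum.cong[OF refl])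
    fix \<sigma> assume "\<sigma> \<in> {\<sigma>. \<sigma> permutes {..<k + l}}"
    then have "permutation \<sigma>" by (auto simp: permutation_permutes)
    then have "sign (?\<tau> \<circ> \<sigma>) = (- sign \<sigma> :: int)"
      using assms(3) by (simp add: sign_compose permutation_swap_id sign_swap_id)
    then show "?f (?\<tau> \<circ> \<sigma>) = - ?f \<sigma>" by (simp add: v)
  qed
  finally have "sum ?f {\<sigma>. \<sigma> permutes {..<k + l}} = 0" by (simp add: sum_negf)
  then show ?thesis by (simp add: wedge_def)
qed

text \<open>In the summand of \<open>\<sigma>\<close> the slot \<open>j\<close> is fed to exactly one of the two factors, according to the position
  of \<open>j\<close> under \<open>\<sigma>\<close>, and the other factor is constant.\<close>

lemma multilinear_wedge:
  fixes \<omega> \<eta> :: "(nat \<Rightarrow> 'v::real_vector) \<Rightarrow> real"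
  assumes "multilinear k \<omega>" "multilinear l \<eta>"
  shows "multilinear (k + l) (wedge k l \<omega> \<eta>)"
  unfolding multilinear_def
proof (intro conjI allI impI)
  show "wedge k l \<omega> \<eta> v = wedge k l \<omega> \<eta> w" if "\<forall>i<k + l. v i = w i" for v w
    by (rule wedge_cong) (use multilinear_cong[OF assms(1)] multilinear_cong[OF assms(2)] that in blast)+
  fix v :: "nat \<Rightarrow> 'v" and j assume j: "j < k + l"
  have "linear (\<lambda>x. of_int (sign \<sigma>) * \<omega> (\<lambda>i. (v(j := x)) (\<sigma> i)) * \<eta> (\<lambda>i. (v(j := x)) (\<sigma> (k + i))))"
    if \<sigma>: "\<sigma> permutes {..<k + l}" for \<sigma>
  proof -
    obtain m where m: "m < k + l" "\<sigma> m = j"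
      using j permutes_image[OF \<sigma>] by (metis imageE lessThan_iff)
    have eq: "\<sigma> i = j \<longleftrightarrow> i = m" for i
      using m(2) permutes_inj[OF \<sigma>] by (auto dest: injD)
    show ?thesis
    proof (cases "m < k")
      case True
      have "(\<lambda>i. (v(j := x)) (\<sigma> i)) = (\<lambda>i. v (\<sigma> i))(m := x)"
        "(\<lambda>i. (v(j := x)) (\<sigma> (k + i))) = (\<lambda>i. v (\<sigma> (k + i)))" for x
        using True by (auto simp: eq)
      then have "(\<lambda>x. of_int (sign \<sigma>) * \<omega> (\<lambda>i. (v(j := x)) (\<sigma> i)) * \<eta> (\<lambda>i. (v(j := x)) (\<sigma> (k + i)))) =
        (\<lambda>x. (of_int (sign \<sigma>) * \<eta> (\<lambda>i. v (\<sigma> (k + i)))) *\<^sub>R \<omega> ((\<lambda>i. v (\<sigma> i))(m := x)))"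
        by (simp add: mult_ac)
      moreover have "linear (\<lambda>x. \<omega> ((\<lambda>i. v (\<sigma> i))(m := x)))"
        by (rule multilinear_linear[OF assms(1) True])
      ultimately show ?thesis by (simp only: linear_compose_scale_right)
    next
      case False
      have "(\<lambda>i. (v(j := x)) (\<sigma> i)) i = (\<lambda>i. v (\<sigma> i)) i" if "i < k" for i x
        using False that by (auto simp: eq)
      then have "\<omega> (\<lambda>i. (v(j := x)) (\<sigma> i)) = \<omega> (\<lambda>i. v (\<sigma> i))" for x
        by (rule multilinear_cong[OF assms(1)])
      moreover have "(\<lambda>i. (v(j := x)) (\<sigma> (k + i))) = (\<lambda>i. v (\<sigma> (k + i)))(m - k := x)" for x
        using False by (auto simp: eq fun_eq_iff)
      ultimately have "(\<lambda>x. of_int (sign \<sigma>) * \<omega> (\<lambda>i. (v(j := x)) (\<sigma> i)) * \<eta> (\<lambda>i. (v(j := x)) (\<sigma> (k + i)))) =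
        (\<lambda>x. (of_int (sign \<sigma>) * \<omega> (\<lambda>i. v (\<sigma> i))) *\<^sub>R \<eta> ((\<lambda>i. v (\<sigma> (k + i)))(m - k := x)))"
        by simp
      moreover have "linear (\<lambda>x. \<eta> ((\<lambda>i. v (\<sigma> (k + i)))(m - k := x)))"
        using False m(1) by (intro multilinear_linear[OF assms(2)]) linarith
      ultimately show ?thesis by (simp only: linear_compose_scale_right)
    qed
  qed
  then have "linear (\<lambda>x. \<Sum>\<sigma> | \<sigma> permutes {..<k + l}. of_int (sign \<sigma>) *
      \<omega> (\<lambda>i. (v(j := x)) (\<sigma> i)) * \<eta> (\<lambda>i. (v(j := x)) (\<sigma> (k + i))))"
    by (intro linear_compose_sum) auto
  from linear_compose_scale_right[OF this, of "1 / (fact k * fact l)"]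
  show "linear (\<lambda>x. wedge k l \<omega> \<eta> (v(j := x)))"
    unfolding wedge_def by simp
qed

lemma multilinear_wedge_power:
  assumes "multilinear k \<omega>"
  shows "multilinear (k * m) (wedge_power k \<omega> m)"
proof (induction m)
  case 0
  then show ?case by (simp add: multilinear_def)
next
  case (Suc m)
  then show ?case using multilinear_wedge[OF assms] by simp
qed

text \<open>Each summand of \<open>B \<and> \<dots> \<and> B\<close> pairs every vector with another one, in particular \<open>v i\<close>.\<close>

lemma wedge_power_degenerate:
  assumes "i < 2 * m" "\<And>j. j < 2 * m \<Longrightarrow> B (v i) (v j) = 0 \<and> B (v j) (v i) = 0"
  shows "wedge_power 2 (\<lambda>v. B (v 0) (v 1)) m v = 0"
  using assms
proof (induction m arbitrary: v i)
  case (Suc m)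
  have "B (v (\<sigma> 0)) (v (\<sigma> 1)) * wedge_power 2 (\<lambda>v. B (v 0) (v 1)) m (\<lambda>i. v (\<sigma> (2 + i))) = 0"
    if \<sigma>: "\<sigma> permutes {..<2 + 2 * m}" for \<sigma>
  proof -
    have in_range: "\<sigma> j < 2 + 2 * m" if "j < 2 + 2 * m" for j
      using permutes_in_image[OF \<sigma>] that by simp
    obtain j where j: "j < 2 + 2 * m" "\<sigma> j = i"
      using Suc.prems(1) permutes_image[OF \<sigma>] by (metis imageE lessThan_iff mult_Suc_right)
    show ?thesis
    proof (cases "j < 2")
      case True
      then have "j = 0 \<or> j = 1" by linarith
      then have "B (v (\<sigma> 0)) (v (\<sigma> 1)) = 0"
        using Suc.prems(2) j in_range[of 0] in_range[of 1] by auto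
      then show ?thesis by simp
    next
      case False
      have "wedge_power 2 (\<lambda>v. B (v 0) (v 1)) m (\<lambda>i. v (\<sigma> (2 + i))) = 0"
      proof (rule Suc.IH[of "j - 2"])
        show "j - 2 < 2 * m" using j False by linarith
        show "B (v (\<sigma> (2 + (j - 2)))) (v (\<sigma> (2 + j'))) = 0 \<and> B (v (\<sigma> (2 + j'))) (v (\<sigma> (2 + (j - 2)))) = 0"
          if "j' < 2 * m" for j'
        proof -
          have "2 + (j - 2) = j" using False by simp
          then show ?thesis using Suc.prems(2)[of "\<sigma> (2 + j')"] in_range[of "2 + j'"] j(2) that by simp
        qed
      qed
      then show ?thesis by simp
    qed
  qed
  then show ?case
    by (auto simp: wedge_def mult.assoc intro!: sum.neutral)
qed simp

text \<open>The entries of \<open>v\<close> are replaced by members of \<open>E\<close> one at a time: in each slot the form is linear, so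
  it vanishes on the span of \<open>E\<close> when it vanishes on \<open>E\<close>.\<close>

lemma top_degree_alternating_form_eq_0:
  fixes \<omega> :: "(nat \<Rightarrow> 'e::real_vector) \<Rightarrow> real"
  assumes "multilinear N \<omega>" "span E = UNIV"
    and "\<And>v. (\<And>i. i < N \<Longrightarrow> v i \<in> E) \<Longrightarrow> \<omega> v = 0"
  shows "\<omega> v = 0"
proof -
  have "\<omega> v = 0" if "k \<le> N" "\<And>i. k \<le> i \<Longrightarrow> i < N \<Longrightarrow> v i \<in> E" for k v
    using that
  proof (induction k arbitrary: v)
    case (Suc k)
    have "linear (\<lambda>x. \<omega> (v(k := x)))" using Suc.prems(1) by (intro multilinear_linear[OF assms(1)]) simp
    moreover have "\<omega> (v(k := x)) = 0" if "x \<in> E" for x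
      by (rule Suc.IH) (use Suc.prems that in auto)
    ultimately have "\<omega> (v(k := v k)) = 0"
      by (rule linear_eq_0_on_span[where b = E]) (use assms(2) in auto)
    then show ?case by simp
  qed (use assms(3) in auto)
  from this[of N v] show ?thesis by simp
qed

text \<open>It suffices to evaluate on a basis made of \<open>u\<close>, further vectors of \<open>ker a\<close> and one vector \<open>z\<close> outside.
  A summand is nonzero only if \<open>a\<close> receives \<open>z\<close>; then \<open>u\<close> is among the vectors of \<open>ker a\<close> that the factors
  \<open>B\<close> pair with each other, and \<open>B u\<close> vanishes on them.\<close>

lemma contact_form_degenerate:
  fixes a :: "'e::euclidean_space \<Rightarrow> real" and B :: "'e \<Rightarrow> 'e \<Rightarrow> real"
  assumes "linear a" "bilinear B" "DIM('e) = 2 * n + 1"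
    and u: "u \<noteq> 0" "a u = 0" "\<And>w. a w = 0 \<Longrightarrow> B u w = 0 \<and> B w u = 0"
  shows "wedge 1 (2 * n) (\<lambda>v. a (v 0)) (wedge_power 2 (\<lambda>v. B (v 0) (v 1)) n) v = 0"
proof (cases "\<forall>z. a z = 0")
  case True
  then show ?thesis by (simp add: wedge_def)
next
  case False
  then obtain z where z: "a z \<noteq> 0" by blast
  interpret a: linear a by fact
  define K where "K = {x. a x = 0}"
  have K: "subspace K" unfolding K_def using linear_subspace_kernel[OF assms(1)] .
  obtain E0 where E0: "{u} \<subseteq> E0" "E0 \<subseteq> K" "independent E0" "K \<subseteq> span E0"
    using maximal_independent_subset_extend[of "{u}" K] u by (auto simp: K_def)
  have spanE0: "span E0 = K" using E0 K by (simp add: span_minimal subset_antisym)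
  define E where "E = insert z E0"
  have indE: "independent E"
    unfolding E_def using E0(3) spanE0 z by (intro independent_insertI) (auto simp: K_def)
  have spanE: "span E = UNIV"
  proof -
    have "x \<in> span E" for x
    proof -
      have "x - (a x / a z) *\<^sub>R z \<in> K" using z by (simp add: K_def a.diff a.scaleR)
      then have "x - (a x / a z) *\<^sub>R z \<in> span E" unfolding E_def
        using spanE0 span_mono[of E0 "insert z E0"] by blast
      moreover have "(a x / a z) *\<^sub>R z \<in> span E" by (intro span_scale span_base) (simp add: E_def)
      ultimately show ?thesis using span_add by fastforce
    qed
    then show ?thesis by blast
  qed
  have cardE: "card E = 2 * n + 1"
    using dim_span_eq_card_independent[OF indE] spanE assms(3) by simp
  have finE: "finite E" using indE by (rule independent_imp_finite)
  let ?B = "\<lambda>v::nat \<Rightarrow> 'e. B (v 0) (v 1)"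
  have "multilinear 2 ?B" unfolding multilinear_def
  proof (intro conjI allI impI)
    fix v :: "nat \<Rightarrow> 'e" and i :: nat assume "i < 2"
    then have "i = 0 \<or> i = 1" by linarith
    then show "linear (\<lambda>x. B ((v(i := x)) 0) ((v(i := x)) 1))"
      using assms(2) by (auto simp: bilinear_def)
  qed auto
  then have mw: "multilinear (2 * n) (wedge_power 2 ?B n)" by (rule multilinear_wedge_power)
  have "multilinear 1 (\<lambda>v::nat \<Rightarrow> 'e. a (v 0))" using assms(1) by (simp add: multilinear_def eta_contract_eq)
  then have mv: "multilinear (1 + 2 * n) (wedge 1 (2 * n) (\<lambda>v. a (v 0)) (wedge_power 2 ?B n))"
    using mw by (rule multilinear_wedge)
  show ?thesis
  proof (rule top_degree_alternating_form_eq_0[OF mv spanE])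
    fix v :: "nat \<Rightarrow> 'e" assume v: "\<And>i. i < 1 + 2 * n \<Longrightarrow> v i \<in> E"
    show "wedge 1 (2 * n) (\<lambda>v. a (v 0)) (wedge_power 2 ?B n) v = 0"
    proof (cases "inj_on v {..<1 + 2 * n}")
      case False
      then obtain i j where "i < 1 + 2 * n" "j < 1 + 2 * n" "i \<noteq> j" "v i = v j"
        unfolding inj_on_def by blast
      then show ?thesis by (rule wedge_alternating)
    next
      case True
      have img: "v ` {..<1 + 2 * n} = E"
        using v card_image[OF True] cardE by (intro card_subset_eq[OF finE]) auto
      have "a (v (\<sigma> 0)) * wedge_power 2 ?B n (\<lambda>i. v (\<sigma> (1 + i))) = 0"
        if \<sigma>: "\<sigma> permutes {..<1 + 2 * n}" for \<sigma>
      proof (cases "v (\<sigma> 0) = z")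
        case False
        have "\<sigma> 0 < 1 + 2 * n" using permutes_in_image[OF \<sigma>, of 0] by simp
        then have "v (\<sigma> 0) \<in> K" using v False E0(2) by (auto simp: E_def)
        then show ?thesis by (simp add: K_def)
      next
        case v0: True
        have in_range: "\<sigma> j < 1 + 2 * n" if "j < 1 + 2 * n" for j
          using permutes_in_image[OF \<sigma>] that by simp
        have "u \<in> v ` \<sigma> ` {..<1 + 2 * n}"
          unfolding permutes_image[OF \<sigma>] img using E0(1) by (auto simp: E_def)
        then obtain m where m: "m < 1 + 2 * n" "v (\<sigma> m) = u" by auto
        have "m \<noteq> 0" using v0 m(2) u(2) z by (intro notI) auto
        have ker: "a (v (\<sigma> (1 + j))) = 0" if "j < 2 * n" for j
        proof -
          have "\<sigma> (1 + j) \<noteq> \<sigma> 0" using permutes_inj[OF \<sigma>] by (simp add: inj_eq)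
          then have "v (\<sigma> (1 + j)) \<noteq> z"
            using True in_range[of 0] in_range[of "1 + j"] that v0 by (auto simp: inj_on_def)
          then have "v (\<sigma> (1 + j)) \<in> E0" using v[OF in_range[of "1 + j"]] that by (auto simp: E_def)
          then show ?thesis using E0(2) by (auto simp: K_def)
        qed
        have "wedge_power 2 ?B n (\<lambda>i. v (\<sigma> (1 + i))) = 0"
        proof (rule wedge_power_degenerate[of "m - 1"])
          show "m - 1 < 2 * n" using m(1) \<open>m \<noteq> 0\<close> by linarith
          show "B (v (\<sigma> (1 + (m - 1)))) (v (\<sigma> (1 + j))) = 0 \<and>
              B (v (\<sigma> (1 + j))) (v (\<sigma> (1 + (m - 1)))) = 0" if "j < 2 * n" for j
          proof -
            have "1 + (m - 1) = m" using \<open>m \<noteq> 0\<close> by simp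
            then show ?thesis using u(3)[OF ker[OF that]] m(2) by simp
          qed
        qed
        then show ?thesis by simp
      qed
      then show ?thesis by (auto simp: wedge_def mult.assoc intro!: sum.neutral)
    qed
  qed
qed

section \<open>Linear contact geometry\<close>

text \<open>The metric dual of the covector \<open>i\<^sub>V B + a(V) a\<close>. For \<open>a = \<alpha>\<close> and \<open>B = d\<alpha>\<close>, Reeb and contact vectors are
  the preimages of explicit covectors under this map.\<close>

definition contact_musical ::
  "('e::euclidean_space \<Rightarrow> real) \<Rightarrow> ('e \<Rightarrow> 'e \<Rightarrow> real) \<Rightarrow> 'e \<Rightarrow> 'e" where
  "contact_musical a B V = (\<Sum>b\<in>Basis. (B V b + a V * a b) *\<^sub>R b)"

text \<open>The values at a point of a contact form \<open>\<alpha>\<close> and of \<open>d\<alpha>\<close>, read in a chart.\<close>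

locale contact_pair =
  fixes a :: "'e::euclidean_space \<Rightarrow> real" and B :: "'e \<Rightarrow> 'e \<Rightarrow> real"
  assumes linear_a: "linear a" and bilinear_B: "bilinear B" and skew: "B u v = - B v u"
    and a_nonzero: "\<exists>z. a z \<noteq> 0"
    and nondegenerate: "a u = 0 \<Longrightarrow> (\<And>w. a w = 0 \<Longrightarrow> B u w = 0) \<Longrightarrow> u = 0"
begin

sublocale a: linear a by (rule linear_a)

lemma B_self [simp]: "B u u = 0"
  using skew[of u u] by simp

lemma linear_B: "linear (\<lambda>u. B u w)" "linear (B u)"
  using bilinear_B by (auto simp: bilinear_def)

abbreviation musical :: "'e \<Rightarrow> 'e" where
  "musical \<equiv> contact_musical a B"

lemmas musical_def = contact_musical_def[of a B]

lemma covector_inner: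
  fixes l :: "'e \<Rightarrow> real"
  assumes "linear l"
  shows "(\<Sum>b\<in>Basis. l b *\<^sub>R b) \<bullet> w = l w"
  using linear_sum_Basis[OF assms, of w]
  by (simp add: inner_sum_left inner_commute[of w] mult.commute)

lemma linear_form: "linear (\<lambda>w. B V w + a V * a w)"
  using linear_compose_add[OF linear_B(2) linear_compose_scale_right[OF linear_a, of "a V"]] by simp

lemma musical_inner: "musical V \<bullet> w = B V w + a V * a w"
  unfolding musical_def by (rule covector_inner[OF linear_form])

lemma linear_musical: "linear musical"
proof (rule linearI)
  interpret Bl: linear "\<lambda>u. B u w" for w by (rule linear_B)
  show "musical (x + y) = musical x + musical y" for x y
    by (rule euclidean_eqI) (simp add: musical_inner inner_add_left Bl.add a.add algebra_simps)
  show "musical (c *\<^sub>R x) = c *\<^sub>R musical x" for c x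
    by (rule euclidean_eqI) (simp add: musical_inner Bl.scaleR a.scaleR algebra_simps)
qed

text \<open>Testing \<open>i\<^sub>V B + a(V) a = 0\<close> on \<open>V\<close> gives \<open>a(V)\<^sup>2 = 0\<close>; what remains, \<open>i\<^sub>V B = 0\<close>, is excluded by
  non-degeneracy.\<close>

lemma inj_musical: "inj musical"
proof (rule linear_injective_0[OF linear_musical, THEN iffD2], intro allI impI)
  fix V assume "musical V = 0"
  then have 0: "B V w + a V * a w = 0" for w using musical_inner[of V w] by simp
  from 0[of V] have "a V = 0" by simp
  then show "V = 0" using nondegenerate 0 by simp
qed

lemma musical_solve:
  assumes "linear l"
  obtains V where "musical V = (\<Sum>b\<in>Basis. l b *\<^sub>R b)" "\<And>w. B V w + a V * a w = l w"
proof -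
  obtain V where V: "musical V = (\<Sum>b\<in>Basis. l b *\<^sub>R b)"
    using linear_inj_imp_surj[OF linear_musical inj_musical] by (metis surjD)
  moreover have "B V w + a V * a w = l w" for w
    using V musical_inner covector_inner[OF assms] by metis
  ultimately show thesis using that by blast
qed

text \<open>The Reeb vector is the preimage \<open>R\<close> of \<open>a\<close>. Testing on \<open>R\<close> gives \<open>a(R)\<^sup>2 = a(R)\<close>. If \<open>a(R)\<close> were \<open>0\<close>, then
  \<open>B R = a\<close> would vanish on \<open>ker a\<close>, so \<open>R = 0\<close> and \<open>a = 0\<close>.\<close>

lemma reeb_exists: obtains R where "a R = 1" "\<And>w. B R w = 0" "musical R = (\<Sum>b\<in>Basis. a b *\<^sub>R b)"
proof -
  obtain R where R: "musical R = (\<Sum>b\<in>Basis. a b *\<^sub>R b)" "\<And>w. B R w + a R * a w = a w"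
    using musical_solve[OF linear_a] by blast
  have "a R \<noteq> 0"
  proof
    assume 0: "a R = 0"
    then have "B R w = a w" for w using R(2)[of w] by simp
    then have "R = 0" using nondegenerate[OF 0] by simp
    then have "a w = 0" for w using \<open>\<And>w. B R w = a w\<close>[of w] linear_0[OF linear_B(1)] by simp
    then show False using a_nonzero by blast
  qed
  moreover have "a R * a R = a R" using R(2)[of R] by simp
  ultimately have "a R = 1" by simp
  moreover from this have "B R w = 0" for w using R(2)[of w] by simp
  ultimately show thesis using that R(1) by blast
qed

text \<open>If \<open>a(X) = g\<close> and \<open>i\<^sub>X B = l(R) a - l\<close>, then the covector of \<open>X\<close> is \<open>(l(R) + g) a - l\<close>. Conversely, the
  preimage of this covector has \<open>a(X) = g\<close>, as testing on the Reeb vector \<open>R\<close> shows.\<close>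

lemma contact_vector_exists:
  assumes "linear l" "a R = 1" "\<And>w. B R w = 0"
  obtains X where "a X = g" "\<And>w. B X w = l R * a w - l w"
    "musical X = (\<Sum>b\<in>Basis. ((l R + g) * a b - l b) *\<^sub>R b)"
proof -
  have "linear (\<lambda>w. (l R + g) * a w - l w)"
    using linear_compose_sub[OF linear_compose_scale_right[OF linear_a, of "l R + g"] assms(1)] by simp
  from musical_solve[OF this] obtain X where X: "musical X = (\<Sum>b\<in>Basis. ((l R + g) * a b - l b) *\<^sub>R b)"
    "\<And>w. B X w + a X * a w = (l R + g) * a w - l w"
    by blast
  have "B X R = 0" using skew[of X R] assms(3) by simp
  then have "a X = g" using X(2)[of R] assms(2) by simp
  moreover from this have "B X w = l R * a w - l w" for w using X(2)[of w] by (simp add: algebra_simps)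
  ultimately show thesis using that X(1) by blast
qed

lemma contact_vector_unique:
  assumes "a X = a X'" "\<And>w. B X w = B X' w"
  shows "X = X'"
proof -
  have "musical X = musical X'" unfolding musical_def using assms by simp
  then show ?thesis using inj_musical by (simp add: inj_eq)
qed

end

section \<open>Charts and tangent vectors\<close>

locale smooth_atlas =
  fixes A :: "('a::{t2_space, second_countable_topology}, 'e::euclidean_space) chart set"
  assumes smooth_structure_A: "smooth_structure A"
begin

lemma chart_is_chart: "c \<in> A \<Longrightarrow> is_chart c"
  using smooth_structure_A by (simp add: smooth_structure_def)

lemma open_dom: "c \<in> A \<Longrightarrow> open (chart_dom c)"
  and open_ran: "c \<in> A \<Longrightarrow> open (chart_ran c)"
  and chart_homeo: "c \<in> A \<Longrightarrow> homeomorphism (chart_dom c) (chart_ran c) (chart_map c) (chart_inv c)"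
  using chart_is_chart by (auto simp: is_chart_def)

lemma inv_map [simp]: "c \<in> A \<Longrightarrow> p \<in> chart_dom c \<Longrightarrow> chart_inv c (chart_map c p) = p"
  using chart_homeo by (simp add: homeomorphism_def)

lemma map_inv [simp]: "c \<in> A \<Longrightarrow> x \<in> chart_ran c \<Longrightarrow> chart_map c (chart_inv c x) = x"
  using chart_homeo by (simp add: homeomorphism_def)

lemma map_in_ran [simp]: "p \<in> chart_dom c \<Longrightarrow> chart_map c p \<in> chart_ran c"
  by (simp add: chart_ran_def)

lemma inv_in_dom [simp]: "c \<in> A \<Longrightarrow> x \<in> chart_ran c \<Longrightarrow> chart_inv c x \<in> chart_dom c"
  using chart_homeo unfolding homeomorphism_def by blast

lemma continuous_on_chart_inv: "c \<in> A \<Longrightarrow> continuous_on (chart_ran c) (chart_inv c)"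
  using chart_homeo by (simp add: homeomorphism_def)

lemma image_Int_dom: "c \<in> A \<Longrightarrow> chart_map c ` (chart_dom c \<inter> U) = chart_ran c \<inter> chart_inv c -` U"
proof (intro equalityI subsetI)
  fix x assume "c \<in> A" "x \<in> chart_ran c \<inter> chart_inv c -` U"
  then show "x \<in> chart_map c ` (chart_dom c \<inter> U)"
    by (intro image_eqI[of _ _ "chart_inv c x"]) auto
qed auto

lemma open_image: "c \<in> A \<Longrightarrow> open U \<Longrightarrow> open (chart_map c ` (chart_dom c \<inter> U))"
  using continuous_open_preimage[OF continuous_on_chart_inv open_ran] by (simp add: image_Int_dom)

definition overlap :: "('a, 'e) chart \<Rightarrow> ('a, 'e) chart \<Rightarrow> 'e set" where
  "overlap c d = chart_map c ` (chart_dom c \<inter> chart_dom d)"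

lemma overlap_iff: "c \<in> A \<Longrightarrow> x \<in> overlap c d \<longleftrightarrow> x \<in> chart_ran c \<and> chart_inv c x \<in> chart_dom d"
  by (auto simp: overlap_def image_Int_dom)

lemma open_overlap: "c \<in> A \<Longrightarrow> d \<in> A \<Longrightarrow> open (overlap c d)"
  unfolding overlap_def by (intro open_image open_dom)

lemma smooth_transition: "c \<in> A \<Longrightarrow> d \<in> A \<Longrightarrow> smooth_on (overlap c d) (transition c d)"
  using smooth_structure_A by (auto simp: smooth_structure_def smooth_compatible_def overlap_def)

lemma transition_map [simp]:
  "c \<in> A \<Longrightarrow> p \<in> chart_dom c \<Longrightarrow> transition c d (chart_map c p) = chart_map d p"
  by (simp add: transition_def)

lemma charts_at_iff: "c \<in> charts_at A p \<longleftrightarrow> c \<in> A \<and> p \<in> chart_dom c"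
  by (auto simp: charts_at_def)

lemma some_chart_in: "some_chart A p \<in> charts_at A p"
proof -
  have "p \<in> (\<Union>c\<in>A. chart_dom c)" using smooth_structure_A by (simp add: smooth_structure_def)
  then have "\<exists>c. c \<in> charts_at A p" by (auto simp: charts_at_def)
  then show ?thesis unfolding some_chart_def by (rule someI_ex)
qed

abbreviation dtrans :: "('a, 'e) chart \<Rightarrow> ('a, 'e) chart \<Rightarrow> 'a \<Rightarrow> 'e \<Rightarrow> 'e" where
  "dtrans c d p \<equiv> frechet_derivative (transition c d) (at (chart_map c p))"

lemma map_in_overlap:
  "c \<in> charts_at A p \<Longrightarrow> d \<in> charts_at A p \<Longrightarrow> chart_map c p \<in> overlap c d"
  by (auto simp: overlap_def charts_at_iff)

lemma has_derivative_transition: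
  assumes "c \<in> charts_at A p" "d \<in> charts_at A p"
  shows "(transition c d has_derivative dtrans c d p) (at (chart_map c p))"
  using smooth_on_imp_has_derivative[OF smooth_transition map_in_overlap] assms
  by (auto simp: charts_at_iff)

lemma linear_dtrans: "c \<in> charts_at A p \<Longrightarrow> d \<in> charts_at A p \<Longrightarrow> linear (dtrans c d p)"
  using has_derivative_transition has_derivative_linear by blast

text \<open>The cocycle identity of the differentials of transition maps. It makes tangent vectors at \<open>p\<close> the
  same as coordinate vectors in any one chart.\<close>

lemma dtrans_dtrans:
  assumes c: "c \<in> charts_at A p" and d: "d \<in> charts_at A p" and e: "e \<in> charts_at A p"
  shows "dtrans d e p (dtrans c d p v) = dtrans c e p v"
proof -
  let ?U = "chart_map c ` (chart_dom c \<inter> (chart_dom d \<inter> chart_dom e))"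
  have cA: "c \<in> A" "d \<in> A" "p \<in> chart_dom c" using assms by (auto simp: charts_at_iff)
  have U: "open ?U" "chart_map c p \<in> ?U"
    using assms by (auto simp: charts_at_iff intro!: open_image open_Int open_dom)
  have "(transition d e \<circ> transition c d has_derivative dtrans d e p \<circ> dtrans c d p) (at (chart_map c p))"
    using diff_chain_at[OF has_derivative_transition[OF c d]] has_derivative_transition[OF d e] cA by simp
  then have "(transition c e has_derivative dtrans d e p \<circ> dtrans c d p) (at (chart_map c p))"
    by (rule has_derivative_transform_within_open[OF _ U]) (use cA in \<open>auto\<close>)
  from frechet_derivative_at[OF this] show ?thesis by (metis comp_apply)
qed

lemma dtrans_self: "c \<in> charts_at A p \<Longrightarrow> dtrans c c p v = v"
proof -
  assume c: "c \<in> charts_at A p"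
  then have "(transition c c has_derivative (\<lambda>v. v)) (at (chart_map c p))"
    by (intro has_derivative_transform_within_open[OF has_derivative_ident open_ran[of c] map_in_ran])
       (auto simp: charts_at_iff transition_def)
  from frechet_derivative_at[OF this] show ?thesis by metis
qed

lemma tvector_of_in: "c \<in> charts_at A p \<Longrightarrow> tvector_of A c p e \<in> tangent_space A p"
  by (auto simp: tangent_space_def tvector_of_def dtrans_dtrans)

lemma tvector_of_same [simp]: "c \<in> charts_at A p \<Longrightarrow> tvector_of A c p e c = e"
  by (simp add: tvector_of_def dtrans_self)

lemma tangent_space_transition:
  "v \<in> tangent_space A p \<Longrightarrow> c \<in> charts_at A p \<Longrightarrow> d \<in> charts_at A p \<Longrightarrow> v d = dtrans c d p (v c)"
  unfolding tangent_space_def by blast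

lemma tvector_of_component:
  assumes "v \<in> tangent_space A p" "c \<in> charts_at A p"
  shows "tvector_of A c p (v c) = v"
proof
  fix d
  show "tvector_of A c p (v c) d = v d"
  proof (cases "d \<in> charts_at A p")
    case True
    then show ?thesis using tangent_space_transition[OF assms True] by (simp add: tvector_of_def)
  next
    case False
    then have "v d = 0" using assms(1) unfolding tangent_space_def by blast
    then show ?thesis using False by (simp add: tvector_of_def)
  qed
qed

lemma tvector_of_linear:
  assumes "c \<in> charts_at A p"
  shows "tvector_of A c p (a *\<^sub>R u + b *\<^sub>R v) = (\<lambda>d. a *\<^sub>R tvector_of A c p u d + b *\<^sub>R tvector_of A c p v d)"
  using linear_dtrans[OF assms] by (auto simp: tvector_of_def fun_eq_iff linear_add linear_scale)

lemma smooth_function_on: "smooth_function A F \<Longrightarrow> c \<in> A \<Longrightarrow> smooth_on (chart_ran c) (F \<circ> chart_inv c)"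
  by (simp add: smooth_function_def)

lemma differential_in_chart:
  assumes F: "smooth_function A F" and v: "v \<in> tangent_space A p" and c: "c \<in> charts_at A p"
  shows "differential A F p v = frechet_derivative (F \<circ> chart_inv c) (at (chart_map c p)) (v c)"
proof -
  let ?d = "some_chart A p"
  have d: "?d \<in> charts_at A p" by (rule some_chart_in)
  have A: "c \<in> A" "?d \<in> A" "p \<in> chart_dom c" "p \<in> chart_dom ?d" using c d by (auto simp: charts_at_iff)
  have "(F \<circ> chart_inv c has_derivative frechet_derivative (F \<circ> chart_inv c) (at (chart_map c p)))
      (at (transition ?d c (chart_map ?d p)))"
    using smooth_on_imp_has_derivative[OF smooth_function_on[OF F A(1)]] A by simp
  from diff_chain_at[OF has_derivative_transition[OF d c] this]
  have "(F \<circ> chart_inv ?d has_derivative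
      frechet_derivative (F \<circ> chart_inv c) (at (chart_map c p)) \<circ> dtrans ?d c p) (at (chart_map ?d p))"
    by (rule has_derivative_transform_within_open[OF _ open_overlap[OF A(2,1)] map_in_overlap[OF d c]])
       (use A in \<open>auto simp: overlap_def\<close>)
  from frechet_derivative_at[OF this] show ?thesis
    unfolding differential_def Let_def tangent_space_transition[OF v d c] by (metis comp_apply)
qed

end

section \<open>The exterior derivative in a chart\<close>

lemma smooth_on_derivative_along:
  fixes f :: "'e::euclidean_space \<Rightarrow> 'f::real_normed_vector"
  assumes "open S" "smooth_on S f" "smooth_on S V"
  shows "smooth_on S (\<lambda>x. frechet_derivative f (at x) (V x))"
proof -
  have "smooth_on S (\<lambda>x. \<Sum>b\<in>Basis. (V x \<bullet> b) *\<^sub>R frechet_derivative f (at x) b)"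
    by (intro smooth_on_sum smooth_on_scaleR smooth_on_inner smooth_on_const smooth_on_derivative assms)
  moreover have "(\<Sum>b\<in>Basis. (V x \<bullet> b) *\<^sub>R frechet_derivative f (at x) b) = frechet_derivative f (at x) (V x)"
    if "x \<in> S" for x
    using linear_frechet_derivative[OF smooth_on_imp_differentiable[OF assms(2) that]]
    by (rule linear_sum_Basis[symmetric])
  ultimately show ?thesis by (rule smooth_on_cong[OF assms(1), rotated])
qed

locale smooth_form = smooth_atlas A
  for A :: "('a::{t2_space, second_countable_topology}, 'e::euclidean_space) chart set" +
  fixes \<alpha> :: "('a, 'e) one_form"
  assumes smooth_\<alpha>: "smooth_one_form A \<alpha>"
begin

abbreviation lrep :: "('a, 'e) chart \<Rightarrow> 'e \<Rightarrow> 'e \<Rightarrow> real" where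
  "lrep \<equiv> local_rep A \<alpha>"

definition dlrep :: "('a, 'e) chart \<Rightarrow> 'e \<Rightarrow> 'e \<Rightarrow> 'e \<Rightarrow> real" where
  "dlrep c x u v = frechet_derivative (\<lambda>x. lrep c x v) (at x) u - frechet_derivative (\<lambda>x. lrep c x u) (at x) v"

lemma smooth_lrep: "c \<in> A \<Longrightarrow> smooth_on (chart_ran c) (\<lambda>x. lrep c x e)"
  using smooth_\<alpha> by (simp add: smooth_one_form_def)

lemma linear_lrep:
  assumes "c \<in> A" "x \<in> chart_ran c"
  shows "linear (lrep c x)"
proof -
  have c: "c \<in> charts_at A (chart_inv c x)" using assms by (simp add: charts_at_iff)
  have *: "lrep c x (a *\<^sub>R u + b *\<^sub>R v) = a * lrep c x u + b * lrep c x v" for a b u v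
    using smooth_\<alpha> tvector_of_in[OF c]
    unfolding local_rep_def tvector_of_linear[OF c] smooth_one_form_def by blast
  show ?thesis using *[of 1 _ 1] *[of _ _ 0] by (intro linearI) auto
qed

lemma lrep_expand:
  assumes "c \<in> A" "x \<in> chart_ran c"
  shows "lrep c x w = (\<Sum>b\<in>Basis. (w \<bullet> b) * lrep c x b)"
  using linear_sum_Basis[OF linear_lrep[OF assms], of w] by simp

lemma alpha_eq_lrep:
  assumes "v \<in> tangent_space A p" "c \<in> charts_at A p"
  shows "\<alpha> p v = lrep c (chart_map c p) (v c)"
  using assms tvector_of_component[OF assms] by (simp add: local_rep_def charts_at_iff)

lemma lrep_derivative_expand:
  assumes "c \<in> A" "x \<in> chart_ran c"
  shows "frechet_derivative (\<lambda>x. lrep c x w) (at x) h =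
    (\<Sum>b\<in>Basis. (w \<bullet> b) * frechet_derivative (\<lambda>x. lrep c x b) (at x) h)"
proof -
  have "((\<lambda>x. \<Sum>b\<in>Basis. (w \<bullet> b) * lrep c x b) has_derivative
      (\<lambda>h. \<Sum>b\<in>Basis. (w \<bullet> b) * frechet_derivative (\<lambda>x. lrep c x b) (at x) h)) (at x)"
    by (intro has_derivative_sum has_derivative_mult_right
        smooth_on_imp_has_derivative[OF smooth_lrep assms(2)] assms(1))
  then have "((\<lambda>x. lrep c x w) has_derivative
      (\<lambda>h. \<Sum>b\<in>Basis. (w \<bullet> b) * frechet_derivative (\<lambda>x. lrep c x b) (at x) h)) (at x)"
    by (rule has_derivative_transform_within_open[OF _ open_ran[OF assms(1)] assms(2)])
       (simp add: lrep_expand[OF assms(1), of _ w])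
  from frechet_derivative_at[OF this] show ?thesis by metis
qed

lemma bilinear_dlrep:
  assumes "c \<in> A" "x \<in> chart_ran c"
  shows "bilinear (dlrep c x)"
proof -
  have l1: "linear (frechet_derivative (\<lambda>x. lrep c x w) (at x))" for w
    using smooth_on_imp_differentiable[OF smooth_lrep[OF assms(1)] assms(2)]
    by (rule linear_frechet_derivative)
  have l2: "linear (\<lambda>w. frechet_derivative (\<lambda>x. lrep c x w) (at x) h)" for h
  proof -
    have "linear (\<lambda>w. \<Sum>b\<in>Basis. (w \<bullet> b) * frechet_derivative (\<lambda>x. lrep c x b) (at x) h)"
      by (intro linearI) (simp_all add: inner_add_left algebra_simps sum.distrib sum_distrib_left)
    moreover have "(\<lambda>w. frechet_derivative (\<lambda>x. lrep c x w) (at x) h) =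
        (\<lambda>w. \<Sum>b\<in>Basis. (w \<bullet> b) * frechet_derivative (\<lambda>x. lrep c x b) (at x) h)"
      by (intro ext lrep_derivative_expand assms)
    ultimately show ?thesis by (simp only:)
  qed
  show ?thesis unfolding bilinear_def dlrep_def
    by (intro conjI allI linear_compose_sub l1 l2)
qed

lemma dlrep_skew: "dlrep c x u v = - dlrep c x v u"
  by (simp add: dlrep_def)

text \<open>Both sides evaluate \<open>\<alpha>\<close> on one tangent vector, given by its components in \<open>c\<close> and in \<open>d\<close>.\<close>

lemma lrep_transition:
  assumes "c \<in> A" "d \<in> A" "x \<in> overlap c d"
  shows "lrep c x e = lrep d (transition c d x) (frechet_derivative (transition c d) (at x) e)"
proof -
  let ?p = "chart_inv c x"
  have c: "c \<in> charts_at A ?p" and d: "d \<in> charts_at A ?p" and x: "chart_map c ?p = x"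
    using assms by (auto simp: charts_at_iff overlap_iff)
  have "tvector_of A d ?p (tvector_of A c ?p e d) = tvector_of A c ?p e"
    by (rule tvector_of_component[OF tvector_of_in[OF c] d])
  moreover have "tvector_of A c ?p e d = frechet_derivative (transition c d) (at x) e"
    using d x by (simp add: tvector_of_def)
  moreover have "chart_inv d (transition c d x) = ?p"
    using assms d by (simp add: transition_def charts_at_iff)
  ultimately show ?thesis by (simp add: local_rep_def)
qed

text \<open>The second derivatives of the transition map enter symmetrically and cancel.\<close>

lemma dlrep_transition:
  assumes c: "c \<in> charts_at A p" and d: "d \<in> charts_at A p"
  shows "dlrep c (chart_map c p) u v = dlrep d (chart_map d p) (dtrans c d p u) (dtrans c d p v)"
proof -
  let ?\<tau> = "transition c d" and ?x = "chart_map c p" and ?y = "chart_map d p"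
  let ?D = "\<lambda>f x. frechet_derivative f (at x)"
  have A: "c \<in> A" "d \<in> A" "p \<in> chart_dom c" "p \<in> chart_dom d" using c d by (auto simp: charts_at_iff)
  have x: "?x \<in> overlap c d" by (rule map_in_overlap[OF c d])
  have y: "?y \<in> chart_ran d" using A by simp
  have O: "open (overlap c d)" using open_overlap A by blast
  have sm: "smooth_on (overlap c d) ?\<tau>" using smooth_transition A by blast
  have key: "?D (\<lambda>x. lrep c x w) ?x h =
      lrep d ?y (?D (\<lambda>x. ?D ?\<tau> x w) ?x h) + ?D (\<lambda>y. lrep d y (?D ?\<tau> ?x w)) ?y (?D ?\<tau> ?x h)" for w h
  proof -
    have "((\<lambda>y. lrep d y b) has_derivative ?D (\<lambda>y. lrep d y b) ?y) (at (?\<tau> ?x))" for b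
      using smooth_on_imp_has_derivative[OF smooth_lrep[OF A(2)] y] A by simp
    then have "((\<lambda>x. lrep d x b) \<circ> ?\<tau> has_derivative ?D (\<lambda>y. lrep d y b) ?y \<circ> ?D ?\<tau> ?x) (at ?x)" for b
      by (rule diff_chain_at[OF has_derivative_transition[OF c d]])
    then have 1: "((\<lambda>x. lrep d (?\<tau> x) b) has_derivative (\<lambda>h. ?D (\<lambda>y. lrep d y b) ?y (?D ?\<tau> ?x h))) (at ?x)" for b
      by (simp add: o_def)
    have 2: "((\<lambda>x. ?D ?\<tau> x w \<bullet> b) has_derivative (\<lambda>h. ?D (\<lambda>x. ?D ?\<tau> x w) ?x h \<bullet> b)) (at ?x)" for b
      by (rule has_derivative_inner_left[OF smooth_on_imp_has_derivative[OF smooth_on_derivative[OF sm] x]])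
    have "((\<lambda>x. \<Sum>b\<in>Basis. (?D ?\<tau> x w \<bullet> b) * lrep d (?\<tau> x) b) has_derivative
      (\<lambda>h. \<Sum>b\<in>Basis. (?D ?\<tau> ?x w \<bullet> b) * ?D (\<lambda>y. lrep d y b) ?y (?D ?\<tau> ?x h) +
         (?D (\<lambda>x. ?D ?\<tau> x w) ?x h \<bullet> b) * lrep d (?\<tau> ?x) b)) (at ?x)"
      by (intro has_derivative_sum has_derivative_mult 1 2)
    moreover have "(\<Sum>b\<in>Basis. (?D ?\<tau> x w \<bullet> b) * lrep d (?\<tau> x) b) = lrep c x w" if "x \<in> overlap c d" for x
    proof -
      have "?\<tau> x \<in> chart_ran d" using that A by (auto simp: overlap_def)
      then show ?thesis
        using lrep_transition[OF A(1,2) that, of w] lrep_expand[OF A(2)] by simp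
    qed
    ultimately have "((\<lambda>x. lrep c x w) has_derivative
      (\<lambda>h. \<Sum>b\<in>Basis. (?D ?\<tau> ?x w \<bullet> b) * ?D (\<lambda>y. lrep d y b) ?y (?D ?\<tau> ?x h) +
         (?D (\<lambda>x. ?D ?\<tau> x w) ?x h \<bullet> b) * lrep d (?\<tau> ?x) b)) (at ?x)"
      by (rule has_derivative_transform_within_open[OF _ O x])
    from frechet_derivative_at[OF this, THEN fun_cong, of h]
    have "(\<Sum>b\<in>Basis. (?D ?\<tau> ?x w \<bullet> b) * ?D (\<lambda>y. lrep d y b) ?y (?D ?\<tau> ?x h) +
         (?D (\<lambda>x. ?D ?\<tau> x w) ?x h \<bullet> b) * lrep d ?y b) = ?D (\<lambda>x. lrep c x w) ?x h"
      by (simp only: transition_map[OF A(1,3)])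
    then show ?thesis
      unfolding lrep_derivative_expand[OF A(2) y, of "?D ?\<tau> ?x w"]
        lrep_expand[OF A(2) y, of "?D (\<lambda>x. ?D ?\<tau> x w) ?x h"]
      by (simp add: sum.distrib add.commute)
  qed
  show ?thesis unfolding dlrep_def key
    using second_derivative_symmetric[OF O x sm, of u v] by simp
qed

lemma ext_deriv_eq_dlrep:
  assumes "u \<in> tangent_space A p" "v \<in> tangent_space A p" "c \<in> charts_at A p"
  shows "ext_deriv A \<alpha> p u v = dlrep c (chart_map c p) (u c) (v c)"
proof -
  let ?d = "some_chart A p"
  have d: "?d \<in> charts_at A p" by (rule some_chart_in)
  have "ext_deriv A \<alpha> p u v = dlrep ?d (chart_map ?d p) (u ?d) (v ?d)"
    by (simp add: ext_deriv_def dlrep_def Let_def)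
  also have "\<dots> = dlrep c (chart_map c p) (u c) (v c)"
    unfolding dlrep_transition[OF d assms(3)]
    using tangent_space_transition[OF _ d assms(3)] assms(1,2) by metis
  finally show ?thesis .
qed

end

section \<open>Reeb and contact vector fields\<close>

lemma wedge_power_cong:
  assumes "\<And>v w. (\<And>i. i < k \<Longrightarrow> v i = w i) \<Longrightarrow> \<omega> v = \<omega> w" "\<And>i. i < k * m \<Longrightarrow> v i = w i"
  shows "wedge_power k \<omega> m v = wedge_power k \<omega> m w"
  using assms(2)
proof (induction m arbitrary: v w)
  case (Suc m)
  show ?case unfolding wedge_power.simps
    by (rule wedge_cong[OF assms(1) Suc.IH]) (use Suc.prems in auto)
qed simp

lemma wedge_pullback:
  "wedge k l \<omega> \<eta> (\<lambda>i. T (v i)) = wedge k l (\<lambda>v. \<omega> (\<lambda>i. T (v i))) (\<lambda>v. \<eta> (\<lambda>i. T (v i))) v"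
  by (simp add: wedge_def)

lemma wedge_power_pullback:
  "wedge_power k \<omega> m (\<lambda>i. T (v i)) = wedge_power k (\<lambda>v. \<omega> (\<lambda>i. T (v i))) m v"
  by (induction m arbitrary: v) (simp_all add: wedge_pullback[where T = T])

locale contact_atlas = smooth_form A \<alpha>
  for A :: "('a::{t2_space, second_countable_topology}, 'e::euclidean_space) chart set"
    and \<alpha> :: "('a, 'e) one_form" +
  fixes n :: nat
  assumes contact: "contact_manifold A n \<alpha>"
begin

text \<open>Only the first \<open>2 * n + 1\<close> members of \<open>v\<close> are tangent vectors, so the others are replaced before
  the form is pulled back to coordinates.\<close>

lemma contact_volume_in_chart:
  assumes "c \<in> charts_at A p" "\<And>i. i < 2 * n + 1 \<Longrightarrow> v i \<in> tangent_space A p"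
  shows "contact_volume A \<alpha> n p v =
    wedge 1 (2 * n) (\<lambda>e. lrep c (chart_map c p) (e 0))
      (wedge_power 2 (\<lambda>e. dlrep c (chart_map c p) (e 0) (e 1)) n) (\<lambda>i. v i c)"
proof -
  let ?T = "tvector_of A c p"
  have "contact_volume A \<alpha> n p v = contact_volume A \<alpha> n p (\<lambda>i. ?T (v i c))"
    unfolding contact_volume_def
  proof (rule wedge_cong)
    show "wedge_power 2 (\<lambda>v. ext_deriv A \<alpha> p (v 0) (v 1)) n v =
        wedge_power 2 (\<lambda>v. ext_deriv A \<alpha> p (v 0) (v 1)) n w" if "\<And>i. i < 2 * n \<Longrightarrow> v i = w i" for v w
      by (rule wedge_power_cong[OF _ that]) auto
    show "v i = ?T (v i c)" if "i < 1 + 2 * n" for i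
      using tvector_of_component[OF assms(2,1)] that by simp
  qed auto
  also have "\<dots> = wedge 1 (2 * n) (\<lambda>e. \<alpha> p (?T (e 0)))
      (wedge_power 2 (\<lambda>e. ext_deriv A \<alpha> p (?T (e 0)) (?T (e 1))) n) (\<lambda>i. v i c)"
    unfolding contact_volume_def wedge_pullback[where T = ?T] wedge_power_pullback[where T = ?T] ..
  finally show ?thesis
    using alpha_eq_lrep[OF tvector_of_in assms(1)] ext_deriv_eq_dlrep[OF tvector_of_in tvector_of_in assms(1)]
      assms(1) by simp
qed

lemma contact_pair_in_chart:
  assumes "c \<in> A" "x \<in> chart_ran c"
  shows "contact_pair (lrep c x) (dlrep c x)"
proof (rule contact_pair.intro)
  let ?p = "chart_inv c x"
  have c: "c \<in> charts_at A ?p" using assms by (simp add: charts_at_iff)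
  obtain v where v: "\<And>i. i < 2 * n + 1 \<Longrightarrow> v i \<in> tangent_space A ?p" "contact_volume A \<alpha> n ?p v \<noteq> 0"
    and dim: "DIM('e) = 2 * n + 1"
    using contact unfolding contact_manifold_def by meson
  have vol: "wedge 1 (2 * n) (\<lambda>e. lrep c x (e 0)) (wedge_power 2 (\<lambda>e. dlrep c x (e 0) (e 1)) n) (\<lambda>i. v i c) \<noteq> 0"
    using contact_volume_in_chart[OF c v(1)] v(2) assms by simp
  show lin: "linear (lrep c x)" by (rule linear_lrep[OF assms])
  show bil: "bilinear (dlrep c x)" by (rule bilinear_dlrep[OF assms])
  show "dlrep c x u v = - dlrep c x v u" for u v by (rule dlrep_skew)
  show "\<exists>z. lrep c x z \<noteq> 0"
  proof (rule ccontr)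
    assume "\<nexists>z. lrep c x z \<noteq> 0"
    then show False using vol by (simp add: wedge_def)
  qed
  show "u = 0" if "lrep c x u = 0" "\<And>w. lrep c x w = 0 \<Longrightarrow> dlrep c x u w = 0" for u
  proof (rule ccontr)
    assume "u \<noteq> 0"
    from contact_form_degenerate[OF lin bil dim this that(1)] show False
      using that(2) vol dlrep_skew[of c x _ u] by simp
  qed
qed

lemma linear_differential_in_chart:
  "smooth_function A F \<Longrightarrow> c \<in> A \<Longrightarrow> x \<in> chart_ran c \<Longrightarrow>
    linear (frechet_derivative (F \<circ> chart_inv c) (at x))"
  using smooth_on_imp_differentiable[OF smooth_function_on] by (intro linear_frechet_derivative) blast

lemma reeb_unique_existence:
  "\<exists>!v. v \<in> tangent_space A p \<and> \<alpha> p v = 1 \<and> (\<forall>w\<in>tangent_space A p. ext_deriv A \<alpha> p v w = 0)"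
proof -
  define c where "c = some_chart A p"
  have c: "c \<in> charts_at A p" unfolding c_def by (rule some_chart_in)
  let ?x = "chart_map c p"
  interpret contact_pair "lrep c ?x" "dlrep c ?x"
    using c by (intro contact_pair_in_chart) (auto simp: charts_at_iff)
  obtain R where R: "lrep c ?x R = 1" "\<And>w. dlrep c ?x R w = 0" using reeb_exists by blast
  show ?thesis
  proof (rule ex1I[of _ "tvector_of A c p R"], intro conjI ballI)
    show in_T: "tvector_of A c p R \<in> tangent_space A p" by (rule tvector_of_in[OF c])
    show "\<alpha> p (tvector_of A c p R) = 1" using alpha_eq_lrep[OF in_T c] R c by simp
    show "ext_deriv A \<alpha> p (tvector_of A c p R) w = 0" if "w \<in> tangent_space A p" for w
      using ext_deriv_eq_dlrep[OF in_T that c] R c by simp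
    fix v assume v: "v \<in> tangent_space A p \<and> \<alpha> p v = 1 \<and> (\<forall>w\<in>tangent_space A p. ext_deriv A \<alpha> p v w = 0)"
    have "v c = R"
    proof (rule contact_vector_unique)
      show "lrep c ?x (v c) = lrep c ?x R" using v alpha_eq_lrep[of v p c] c R by simp
      show "dlrep c ?x (v c) w = dlrep c ?x R w" for w
        using v ext_deriv_eq_dlrep[of v p "tvector_of A c p w" c] tvector_of_in[OF c, of w] c R by simp
    qed
    then show "v = tvector_of A c p R" using tvector_of_component[of v p c] v c by simp
  qed
qed

lemma reeb_tangent: "reeb A \<alpha> p \<in> tangent_space A p"
  and alpha_reeb: "\<alpha> p (reeb A \<alpha> p) = 1"
  and ext_deriv_reeb: "w \<in> tangent_space A p \<Longrightarrow> ext_deriv A \<alpha> p (reeb A \<alpha> p) w = 0"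
  using theI'[OF reeb_unique_existence[of p]] unfolding reeb_def by blast+

lemma reeb_in_chart:
  assumes c: "c \<in> charts_at A p"
  shows "lrep c (chart_map c p) (reeb A \<alpha> p c) = 1" "dlrep c (chart_map c p) (reeb A \<alpha> p c) w = 0"
  using alpha_reeb[of p] alpha_eq_lrep[OF reeb_tangent c]
    ext_deriv_reeb[OF tvector_of_in[OF c, of w]]
    ext_deriv_eq_dlrep[OF reeb_tangent tvector_of_in[OF c, of w] c] c by simp_all

lemma contact_vector_field_unique_existence:
  assumes F: "smooth_function A F"
  shows "\<exists>!v. v \<in> tangent_space A p \<and> \<alpha> p v = F p \<and>
     (\<forall>w\<in>tangent_space A p. ext_deriv A \<alpha> p v w =
        differential A F p (reeb A \<alpha> p) * \<alpha> p w - differential A F p w)"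
proof -
  define c where "c = some_chart A p"
  have c: "c \<in> charts_at A p" unfolding c_def by (rule some_chart_in)
  let ?x = "chart_map c p" and ?R = "reeb A \<alpha> p c"
  let ?l = "frechet_derivative (F \<circ> chart_inv c) (at ?x)"
  have cA: "c \<in> A" "?x \<in> chart_ran c" using c by (auto simp: charts_at_iff)
  interpret contact_pair "lrep c ?x" "dlrep c ?x" by (rule contact_pair_in_chart[OF cA])
  obtain X where X: "lrep c ?x X = F p" "\<And>w. dlrep c ?x X w = ?l ?R * lrep c ?x w - ?l w"
    using contact_vector_exists[OF linear_differential_in_chart[OF F cA] reeb_in_chart[OF c]] by blast
  have dR: "differential A F p (reeb A \<alpha> p) = ?l ?R" by (rule differential_in_chart[OF F reeb_tangent c])
  show ?thesis unfolding dR
  proof (rule ex1I[of _ "tvector_of A c p X"], intro conjI ballI)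
    show in_T: "tvector_of A c p X \<in> tangent_space A p" by (rule tvector_of_in[OF c])
    show "\<alpha> p (tvector_of A c p X) = F p" using alpha_eq_lrep[OF in_T c] X c by simp
    show "ext_deriv A \<alpha> p (tvector_of A c p X) w = ?l ?R * \<alpha> p w - differential A F p w"
      if "w \<in> tangent_space A p" for w
      using ext_deriv_eq_dlrep[OF in_T that c] alpha_eq_lrep[OF that c] differential_in_chart[OF F that c] X c
      by simp
    fix v assume v: "v \<in> tangent_space A p \<and> \<alpha> p v = F p \<and>
      (\<forall>w\<in>tangent_space A p. ext_deriv A \<alpha> p v w = ?l ?R * \<alpha> p w - differential A F p w)"
    have "v c = X"
    proof (rule contact_vector_unique)
      show "lrep c ?x (v c) = lrep c ?x X" using v alpha_eq_lrep[of v p c] c X by simp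
      show "dlrep c ?x (v c) w = dlrep c ?x X w" for w
      proof -
        let ?w = "tvector_of A c p w"
        have w: "?w \<in> tangent_space A p" by (rule tvector_of_in[OF c])
        have "dlrep c ?x (v c) w = ext_deriv A \<alpha> p v ?w"
          using v ext_deriv_eq_dlrep[of v p ?w c] w c by simp
        also have "\<dots> = ?l ?R * \<alpha> p ?w - differential A F p ?w" using v w by blast
        finally show ?thesis
          using alpha_eq_lrep[OF w c] differential_in_chart[OF F w c] X(2) c by simp
      qed
    qed
    then show "v = tvector_of A c p X" using tvector_of_component[of v p c] v c by simp
  qed
qed

lemma contact_vector_field:
  assumes "smooth_function A F"
  shows contact_vector_field_tangent: "contact_vector_field A \<alpha> F p \<in> tangent_space A p"
    and "\<alpha> p (contact_vector_field A \<alpha> F p) = F p"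
    and "w \<in> tangent_space A p \<Longrightarrow>
      ext_deriv A \<alpha> p (contact_vector_field A \<alpha> F p) w =
        differential A F p (reeb A \<alpha> p) * \<alpha> p w - differential A F p w"
  using theI'[OF contact_vector_field_unique_existence[OF assms, of p]]
  unfolding contact_vector_field_def by blast+

lemma contact_vector_fieldI:
  assumes "smooth_function A F" "v \<in> tangent_space A p" "\<alpha> p v = F p"
    "\<And>w. w \<in> tangent_space A p \<Longrightarrow> ext_deriv A \<alpha> p v w =
        differential A F p (reeb A \<alpha> p) * \<alpha> p w - differential A F p w"
  shows "contact_vector_field A \<alpha> F p = v"
  unfolding contact_vector_field_def
  by (rule the1_equality[OF contact_vector_field_unique_existence[OF assms(1)]]) (use assms in blast)

section \<open>Smoothness of the contact bracket\<close>

lemma smooth_dlrep: "c \<in> A \<Longrightarrow> smooth_on (chart_ran c) (\<lambda>x. dlrep c x u v)"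
  unfolding dlrep_def by (intro smooth_on_diff smooth_on_derivative smooth_lrep open_ran)

lemma smooth_musical: "c \<in> A \<Longrightarrow> smooth_on (chart_ran c) (\<lambda>x. contact_musical (lrep c x) (dlrep c x) v)"
  unfolding contact_musical_def
  by (intro smooth_on_sum smooth_on_scaleR smooth_on_add smooth_on_mult smooth_dlrep smooth_lrep
      smooth_on_const open_ran)

text \<open>The form in which the smooth dependence of solutions is applied: Reeb and contact vector
  fields solve such systems in every chart.\<close>

lemma smooth_musical_solution:
  assumes c: "c \<in> A" and b: "smooth_on (chart_ran c) b"
    and "\<And>x. x \<in> chart_ran c \<Longrightarrow> contact_musical (lrep c x) (dlrep c x) (V x) = b x"
  shows "smooth_on (chart_ran c) V"
  by (rule smooth_on_linear_solution[where L = "\<lambda>x. contact_musical (lrep c x) (dlrep c x)",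
        OF open_ran[OF c] _ _ smooth_musical[OF c] b assms(3)])
     (use contact_pair.linear_musical contact_pair.inj_musical contact_pair_in_chart[OF c] in blast)+

lemma smooth_reeb:
  assumes c: "c \<in> A"
  shows "smooth_on (chart_ran c) (\<lambda>x. reeb A \<alpha> (chart_inv c x) c)"
proof (rule smooth_musical_solution[OF c])
  show "smooth_on (chart_ran c) (\<lambda>x. \<Sum>b\<in>Basis. lrep c x b *\<^sub>R b)"
    by (intro smooth_on_sum smooth_on_scaleR smooth_lrep smooth_on_const open_ran c)
  fix x assume x: "x \<in> chart_ran c"
  then have "c \<in> charts_at A (chart_inv c x)" using c by (simp add: charts_at_iff)
  from reeb_in_chart[OF this]
  show "contact_musical (lrep c x) (dlrep c x) (reeb A \<alpha> (chart_inv c x) c) =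
      (\<Sum>b\<in>Basis. lrep c x b *\<^sub>R b)"
    using c x by (simp add: contact_musical_def)
qed

lemma smooth_contact_vector_field:
  assumes c: "c \<in> A" and F: "smooth_function A F"
  shows "smooth_on (chart_ran c) (\<lambda>x. contact_vector_field A \<alpha> F (chart_inv c x) c)"
proof (rule smooth_musical_solution[OF c])
  let ?R = "\<lambda>x. reeb A \<alpha> (chart_inv c x) c"
  let ?D = "\<lambda>x. frechet_derivative (F \<circ> chart_inv c) (at x)"
  show "smooth_on (chart_ran c) (\<lambda>x. \<Sum>b\<in>Basis.
      (?D x (?R x) * lrep c x b - ?D x b + (F \<circ> chart_inv c) x * lrep c x b) *\<^sub>R b)"
    by (intro smooth_on_sum smooth_on_scaleR smooth_on_add smooth_on_diff smooth_on_mult smooth_lrep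
        smooth_on_derivative_along smooth_on_derivative smooth_function_on[OF F] smooth_reeb
        smooth_on_const open_ran c)
  fix x assume x: "x \<in> chart_ran c"
  let ?p = "chart_inv c x" and ?X = "contact_vector_field A \<alpha> F (chart_inv c x)"
  have cp: "c \<in> charts_at A ?p" using c x by (simp add: charts_at_iff)
  note X = contact_vector_field[OF F, where p = ?p]
  have "lrep c x (?X c) = F ?p" using alpha_eq_lrep[OF X(1) cp] X(2) c x by simp
  moreover have "dlrep c x (?X c) b = ?D x (?R x) * lrep c x b - ?D x b" for b
  proof -
    let ?w = "tvector_of A c ?p b"
    have w: "?w \<in> tangent_space A ?p" by (rule tvector_of_in[OF cp])
    show ?thesis
      using ext_deriv_eq_dlrep[OF X(1) w cp] X(3)[OF w] alpha_eq_lrep[OF w cp]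
        differential_in_chart[OF F w cp] differential_in_chart[OF F reeb_tangent cp] c x cp by simp
  qed
  ultimately show "contact_musical (lrep c x) (dlrep c x) (?X c) = (\<Sum>b\<in>Basis.
      (?D x (?R x) * lrep c x b - ?D x b + (F \<circ> chart_inv c) x * lrep c x b) *\<^sub>R b)"
    by (simp add: contact_musical_def)
qed

lemma smooth_contact_bracket:
  assumes F: "smooth_function A F" and G: "smooth_function A G"
  shows "smooth_function A (contact_bracket A \<alpha> F G)"
  unfolding smooth_function_def
proof
  fix c assume c: "c \<in> A"
  let ?X = "\<lambda>x. contact_vector_field A \<alpha> G (chart_inv c x) c" and ?R = "\<lambda>x. reeb A \<alpha> (chart_inv c x) c"
  have "smooth_on (chart_ran c) (\<lambda>x. frechet_derivative (F \<circ> chart_inv c) (at x) (?X x) -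
      frechet_derivative (G \<circ> chart_inv c) (at x) (?R x) * (F \<circ> chart_inv c) x)"
    by (intro smooth_on_diff smooth_on_mult smooth_on_derivative_along smooth_function_on F G
        smooth_contact_vector_field smooth_reeb open_ran c)
  then show "smooth_on (chart_ran c) (contact_bracket A \<alpha> F G \<circ> chart_inv c)"
  proof (rule smooth_on_cong[OF open_ran[OF c], rotated])
    fix x assume x: "x \<in> chart_ran c"
    have cp: "c \<in> charts_at A (chart_inv c x)" using c x by (simp add: charts_at_iff)
    show "frechet_derivative (F \<circ> chart_inv c) (at x) (?X x) -
      frechet_derivative (G \<circ> chart_inv c) (at x) (?R x) * (F \<circ> chart_inv c) x =
      (contact_bracket A \<alpha> F G \<circ> chart_inv c) x"
      using differential_in_chart[OF F contact_vector_field_tangent[OF G] cp]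
        differential_in_chart[OF G reeb_tangent cp] c x
      by (simp add: contact_bracket_def)
  qed
qed

end

section \<open>Functions vanishing on a submanifold\<close>

text \<open>\<open>f\<close> need not vanish on a neighbourhood of \<open>x\<close>, only along the line through \<open>x\<close> in direction \<open>h\<close>.\<close>

lemma derivative_eq_0_along_line:
  fixes f :: "'e::real_normed_vector \<Rightarrow> 'f::real_normed_vector"
  assumes "(f has_derivative f') (at x)" "open U" "x \<in> U" "\<And>t. x + t *\<^sub>R h \<in> U \<Longrightarrow> f (x + t *\<^sub>R h) = 0"
  shows "f' h = 0"
proof -
  have "((\<lambda>t. x + t *\<^sub>R h) has_derivative (\<lambda>t. t *\<^sub>R h)) (at 0)"
    by (auto intro!: derivative_eq_intros)
  moreover have "(f has_derivative f') (at (x + 0 *\<^sub>R h))" using assms(1) by simp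
  ultimately have "(f \<circ> (\<lambda>t. x + t *\<^sub>R h) has_derivative f' \<circ> (\<lambda>t. t *\<^sub>R h)) (at 0)"
    by (rule diff_chain_at)
  then have "((\<lambda>t. 0) has_derivative f' \<circ> (\<lambda>t. t *\<^sub>R h)) (at 0)"
  proof (rule has_derivative_transform_within_open)
    show "open ((\<lambda>t. x + t *\<^sub>R h) -` U)"
      by (intro open_vimage assms(2) continuous_intros)
    show "0 \<in> (\<lambda>t. x + t *\<^sub>R h) -` U" using assms(3) by simp
  qed (use assms(4) in auto)
  then have "f' \<circ> (\<lambda>t::real. t *\<^sub>R h) = (\<lambda>t. 0)"
    using has_derivative_unique has_derivative_const by blast
  then have "(f' \<circ> (\<lambda>t::real. t *\<^sub>R h)) 1 = 0" by simp
  then show ?thesis by simp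
qed

lemma zero_off_support: "p \<notin> closure {p. F p \<noteq> 0} \<Longrightarrow> F p = 0"
  using closure_subset[of "{p. F p \<noteq> 0}"] by blast

context smooth_atlas
begin

lemma smooth_function_add:
  assumes "smooth_function A F" "smooth_function A G"
  shows "smooth_function A (\<lambda>p. F p + G p)"
  unfolding smooth_function_def
proof
  fix c assume c: "c \<in> A"
  have "smooth_on (chart_ran c) (\<lambda>x. (F \<circ> chart_inv c) x + (G \<circ> chart_inv c) x)"
    using assms c by (intro smooth_on_add open_ran smooth_function_on)
  then show "smooth_on (chart_ran c) ((\<lambda>p. F p + G p) \<circ> chart_inv c)" by (simp add: o_def)
qed

lemma smooth_function_scale:
  assumes "smooth_function A F"
  shows "smooth_function A (\<lambda>p. a * F p)"
  unfolding smooth_function_def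
proof
  fix c assume c: "c \<in> A"
  have "smooth_on (chart_ran c) (\<lambda>x. a * (F \<circ> chart_inv c) x)"
    using assms c by (intro smooth_on_mult smooth_on_const open_ran smooth_function_on)
  then show "smooth_on (chart_ran c) ((\<lambda>p. a * F p) \<circ> chart_inv c)" by (simp add: o_def)
qed

lemma smooth_function_const: "smooth_function A (\<lambda>p. a)"
  unfolding smooth_function_def by (simp add: o_def smooth_on_const)

lemma compactly_supported_smoothI:
  assumes "smooth_function A F" "compact K" "\<And>p. p \<notin> K \<Longrightarrow> F p = 0"
  shows "F \<in> compactly_supported_smooth A"
proof -
  have "closure {p. F p \<noteq> 0} \<subseteq> K"
    using assms(3) compact_imp_closed[OF assms(2)] by (intro closure_minimal) auto
  then have "compact (closure {p. F p \<noteq> 0})"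
    using compact_Int_closed[OF assms(2) closed_closure, of "{p. F p \<noteq> 0}"] by (simp add: Int_absorb1)
  then show ?thesis using assms(1) by (simp add: compactly_supported_smooth_def)
qed

lemma compact_support_add:
  assumes "F \<in> compactly_supported_smooth A" "G \<in> compactly_supported_smooth A"
  shows "(\<lambda>p. F p + G p) \<in> compactly_supported_smooth A"
proof (rule compactly_supported_smoothI)
  let ?K = "closure {p. F p \<noteq> 0} \<union> closure {p. G p \<noteq> 0}"
  show "compact ?K" using assms by (simp add: compactly_supported_smooth_def compact_Un)
  show "F p + G p = 0" if "p \<notin> ?K" for p
    using that zero_off_support[of p F] zero_off_support[of p G] by simp
qed (use assms smooth_function_add in \<open>auto simp: compactly_supported_smooth_def\<close>)

lemma compact_support_scale:
  assumes "F \<in> compactly_supported_smooth A"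
  shows "(\<lambda>p. a * F p) \<in> compactly_supported_smooth A"
proof (rule compactly_supported_smoothI)
  let ?K = "closure {p. F p \<noteq> 0}"
  show "compact ?K" using assms by (simp add: compactly_supported_smooth_def)
  show "a * F p = 0" if "p \<notin> ?K" for p
    using zero_off_support[OF that] by simp
qed (use assms smooth_function_scale in \<open>auto simp: compactly_supported_smooth_def\<close>)

text \<open>The function is \<open>l\<close> in the chart, multiplied by a bump function. As \<open>l\<close> vanishes at the base point,
  the derivative of the bump function does not contribute to the differential there.\<close>

lemma extension_of_chart_covector:
  assumes c: "c \<in> charts_at A p" and l: "bounded_linear l" and lp: "l (chart_map c p) = 0"
  obtains G where "G \<in> compactly_supported_smooth A"
    "frechet_derivative (G \<circ> chart_inv c) (at (chart_map c p)) = l"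
    "\<And>q. q \<in> chart_dom c \<Longrightarrow> l (chart_map c q) = 0 \<Longrightarrow> G q = 0"
    "\<And>q. q \<notin> chart_dom c \<Longrightarrow> G q = 0"
proof -
  let ?x = "chart_map c p"
  have cA: "c \<in> A" "p \<in> chart_dom c" using c by (auto simp: charts_at_iff)
  obtain \<phi> :: "'e \<Rightarrow> real" and K where \<phi>: "smooth_on UNIV \<phi>" "\<phi> ?x = 1"
    and K: "compact K" "K \<subseteq> chart_ran c" "\<And>x. x \<notin> K \<Longrightarrow> \<phi> x = 0"
    using smooth_bump_exists[OF open_ran[OF cA(1)] map_in_ran[OF cA(2)]] by metis
  define g where "g = (\<lambda>x. \<phi> x * l x)"
  define G where "G = (\<lambda>q. if q \<in> chart_dom c then g (chart_map c q) else 0)"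
  define K' where "K' = chart_inv c ` K"
  have smg: "smooth_on UNIV g" unfolding g_def
    by (intro smooth_on_mult \<phi> smooth_on_bounded_linear_comp[OF _ l smooth_on_ident]) auto
  have K': "compact K'" unfolding K'_def
    using continuous_on_subset[OF continuous_on_chart_inv[OF cA(1)] K(2)] K(1)
    by (rule compact_continuous_image)
  have K'_dom: "K' \<subseteq> chart_dom c" using K(2) cA(1) by (auto simp: K'_def)
  have G0: "G q = 0" if "q \<notin> K'" for q
  proof (cases "q \<in> chart_dom c")
    case True
    then have "chart_map c q \<notin> K" using that cA(1) unfolding K'_def by (metis image_eqI inv_map)
    then show ?thesis using K(3) by (simp add: G_def g_def)
  qed (simp add: G_def)
  have G_chart: "(G \<circ> chart_inv c) x = g x" if "x \<in> chart_ran c" for x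
    using that cA(1) by (simp add: G_def)
  have "smooth_function A G" unfolding smooth_function_def
  proof (intro ballI smooth_on_locally)
    fix d x assume d: "d \<in> A" and x: "x \<in> chart_ran d"
    show "\<exists>T. open T \<and> x \<in> T \<and> smooth_on T (G \<circ> chart_inv d)"
    proof (cases "chart_inv d x \<in> chart_dom c")
      case True
      have "smooth_on (overlap d c) (g \<circ> transition d c)"
        by (rule smooth_on_compose[OF _ open_UNIV _ smooth_transition smg])
           (use open_overlap d cA in auto)
      then have "smooth_on (overlap d c) (G \<circ> chart_inv d)"
        by (rule smooth_on_cong[OF open_overlap[OF d cA(1)], rotated])
           (use d cA in \<open>auto simp: overlap_iff G_def transition_def\<close>)
      then show ?thesis using True x open_overlap[OF d cA(1)] overlap_iff[OF d] by blast
    next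
      case False
      let ?U = "chart_map d ` (chart_dom d \<inter> - K')"
      have U: "open ?U" using d compact_imp_closed[OF K'] by (intro open_image) auto
      have "x \<in> ?U" using False K'_dom d x by (auto simp: image_Int_dom)
      moreover have "smooth_on ?U (G \<circ> chart_inv d)"
        by (rule smooth_on_cong[OF U _ smooth_on_const[of _ 0]]) (use d G0 in auto)
      ultimately show ?thesis using U by blast
    qed
  qed
  then have "G \<in> compactly_supported_smooth A"
    using K' G0 by (rule compactly_supported_smoothI)
  moreover have "frechet_derivative (G \<circ> chart_inv c) (at ?x) = l"
  proof -
    have "(g has_derivative (\<lambda>h. \<phi> ?x * l h + frechet_derivative \<phi> (at ?x) h * l ?x)) (at ?x)"
      unfolding g_def
      by (intro has_derivative_mult bounded_linear_imp_has_derivative[OF l]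
          smooth_on_imp_has_derivative[OF \<phi>(1)]) auto
    then have "(g has_derivative l) (at ?x)" using \<phi>(2) lp by simp
    then have "(G \<circ> chart_inv c has_derivative l) (at ?x)"
      by (rule has_derivative_transform_within_open[OF _ open_ran[OF cA(1)] map_in_ran[OF cA(2)]])
         (rule G_chart[symmetric])
    then show ?thesis by (rule frechet_derivative_at[symmetric])
  qed
  ultimately show thesis using that by (simp add: G_def g_def)
qed

lemma slice_chart_extension:
  assumes "slice_chart A Y c S" "p \<in> Y" "p \<in> chart_dom c" "linear l" "\<And>x. x \<in> S \<Longrightarrow> l x = 0"
  obtains G where "G \<in> vanishing_ideal A Y" "\<And>v. v \<in> tangent_space A p \<Longrightarrow> differential A G p v = l (v c)"
proof -
  have c: "c \<in> charts_at A p" using assms by (simp add: slice_chart_def charts_at_iff)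
  have S: "chart_map c q \<in> S" if "q \<in> Y" "q \<in> chart_dom c" for q
    using assms(1) that unfolding slice_chart_def by blast
  have l: "bounded_linear l" using assms(4) by (simp add: linear_conv_bounded_linear)
  obtain G where G: "G \<in> compactly_supported_smooth A"
    "frechet_derivative (G \<circ> chart_inv c) (at (chart_map c p)) = l"
    "\<And>q. q \<in> chart_dom c \<Longrightarrow> l (chart_map c q) = 0 \<Longrightarrow> G q = 0"
    "\<And>q. q \<notin> chart_dom c \<Longrightarrow> G q = 0"
    using extension_of_chart_covector[OF c l assms(5)[OF S[OF assms(2,3)]]] by metis
  have "G q = 0" if "q \<in> Y" for q using G(3,4) S[OF that] assms(5) by blast
  then have "G \<in> vanishing_ideal A Y" using G(1) by (simp add: vanishing_ideal_def)
  moreover have "differential A G p v = l (v c)" if "v \<in> tangent_space A p" for v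
    using differential_in_chart[OF _ that c] G(1,2) by (simp add: compactly_supported_smooth_def)
  ultimately show thesis using that by blast
qed

text \<open>Directions in the slice \<open>S\<close> stay in \<open>Y\<close> for a short time, since \<open>Y\<close> is \<open>S\<close> in the chart.\<close>

lemma differential_eq_0_on_slice:
  assumes "slice_chart A Y c S" "p \<in> Y" "p \<in> chart_dom c" "F \<in> vanishing_ideal A Y"
    and "v \<in> tangent_space A p" "v c \<in> S"
  shows "differential A F p v = 0"
proof -
  have c: "c \<in> charts_at A p" "c \<in> A" using assms by (auto simp: slice_chart_def charts_at_iff)
  have F: "smooth_function A F" "\<And>q. q \<in> Y \<Longrightarrow> F q = 0"
    using assms(4) by (auto simp: vanishing_ideal_def compactly_supported_smooth_def)
  have S: "subspace S" "chart_map c ` (Y \<inter> chart_dom c) = S \<inter> chart_ran c"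
    using assms(1) by (auto simp: slice_chart_def)
  have pS: "chart_map c p \<in> S" using S(2) assms(2,3) by blast
  have "frechet_derivative (F \<circ> chart_inv c) (at (chart_map c p)) (v c) = 0"
  proof (rule derivative_eq_0_along_line[where U = "chart_ran c" and h = "v c"])
    show "(F \<circ> chart_inv c has_derivative frechet_derivative (F \<circ> chart_inv c) (at (chart_map c p)))
        (at (chart_map c p))"
      using smooth_on_imp_has_derivative[OF smooth_function_on[OF F(1) c(2)] map_in_ran[OF assms(3)]] .
    show "open (chart_ran c)" "chart_map c p \<in> chart_ran c" using c assms(3) open_ran by auto
    fix t assume t: "chart_map c p + t *\<^sub>R v c \<in> chart_ran c"
    have "chart_map c p + t *\<^sub>R v c \<in> S"
      using S(1) pS assms(6) by (intro subspace_add subspace_scale)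
    with t have "chart_map c p + t *\<^sub>R v c \<in> chart_map c ` (Y \<inter> chart_dom c)" unfolding S(2) by blast
    then obtain q where "q \<in> Y" "q \<in> chart_dom c" "chart_map c p + t *\<^sub>R v c = chart_map c q" by blast
    then show "(F \<circ> chart_inv c) (chart_map c p + t *\<^sub>R v c) = 0" using F(2) c(2) by simp
  qed
  then show ?thesis using differential_in_chart[OF F(1) assms(5) c(1)] by simp
qed

text \<open>The component \<open>z\<close> of \<open>v c\<close> orthogonal to \<open>S\<close> defines a covector that kills \<open>S\<close>, and its extension to a
  member of the ideal detects \<open>z\<close>.\<close>

lemma mem_slice_if_differentials_vanish:
  assumes "slice_chart A Y c S" "p \<in> Y" "p \<in> chart_dom c" "v \<in> tangent_space A p"
    and "\<And>F. F \<in> vanishing_ideal A Y \<Longrightarrow> differential A F p v = 0"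
  shows "v c \<in> S"
proof -
  have S: "subspace S" using assms(1) by (simp add: slice_chart_def)
  obtain y z where yz: "y \<in> span S" "\<And>w. w \<in> span S \<Longrightarrow> orthogonal z w" "v c = y + z"
    using orthogonal_subspace_decomp_exists by blast
  have "linear (\<lambda>x. z \<bullet> x)" by (intro bounded_linear.linear bounded_linear_inner_right)
  moreover have "z \<bullet> x = 0" if "x \<in> S" for x using yz(2) that by (simp add: orthogonal_def span_base)
  ultimately obtain G where G: "G \<in> vanishing_ideal A Y"
    "\<And>v. v \<in> tangent_space A p \<Longrightarrow> differential A G p v = z \<bullet> v c"
    using slice_chart_extension[OF assms(1-3)] by metis
  have "z \<bullet> v c = 0" using G(2)[OF assms(4)] assms(5)[OF G(1)] by simp
  then have "z \<bullet> z = 0" using yz by (simp add: inner_add_right orthogonal_def)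
  then show ?thesis using yz span_eq_iff[THEN iffD2, OF S] by simp
qed

text \<open>The second description does not mention charts, so the first one holds for every slice chart
  around \<open>p\<close> as soon as it holds for one.\<close>

lemma sub_tangent_space_iff:
  assumes "slice_chart A Y c S" "p \<in> Y" "p \<in> chart_dom c"
  shows "v \<in> sub_tangent_space A Y p \<longleftrightarrow> v \<in> tangent_space A p \<and> v c \<in> S"
    and "v \<in> sub_tangent_space A Y p \<longleftrightarrow>
      v \<in> tangent_space A p \<and> (\<forall>F\<in>vanishing_ideal A Y. differential A F p v = 0)"
  using differential_eq_0_on_slice[OF _ assms(2)] mem_slice_if_differentials_vanish[OF assms] assms
  unfolding sub_tangent_space_def by blast+

end

section \<open>Coisotropic submanifolds and their vanishing ideals\<close>

context contact_atlas
begin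

text \<open>The bracket is a first-order operator in \<open>F\<close>, so its support is contained in that of \<open>F\<close>.\<close>

lemma contact_bracket_compactly_supported:
  assumes "F \<in> compactly_supported_smooth A" "G \<in> compactly_supported_smooth A"
  shows "contact_bracket A \<alpha> F G \<in> compactly_supported_smooth A"
proof (rule compactly_supported_smoothI)
  let ?K = "closure {p. F p \<noteq> 0}"
  have sm: "smooth_function A F" "smooth_function A G"
    using assms by (auto simp: compactly_supported_smooth_def)
  show "smooth_function A (contact_bracket A \<alpha> F G)" by (rule smooth_contact_bracket[OF sm])
  show "compact ?K" using assms(1) by (simp add: compactly_supported_smooth_def)
  fix p assume p: "p \<notin> ?K"
  let ?c = "some_chart A p"
  have c: "?c \<in> charts_at A p" "?c \<in> A" "p \<in> chart_dom ?c"
    using some_chart_in[of p] by (auto simp: charts_at_iff)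
  have F0: "F q = 0" if "q \<notin> ?K" for q using that by (rule zero_off_support)
  let ?U = "chart_map ?c ` (chart_dom ?c \<inter> - ?K)"
  have U: "open ?U" "chart_map ?c p \<in> ?U" using c p by (auto intro!: open_image)
  have "(F \<circ> chart_inv ?c has_derivative (\<lambda>h. 0)) (at (chart_map ?c p))"
  proof (rule has_derivative_transform_within_open[OF has_derivative_const[of 0] U])
    fix x assume "x \<in> ?U"
    then have "chart_inv ?c x \<notin> ?K" by (auto simp: image_Int_dom[OF c(2)])
    from F0[OF this] show "0 = (F \<circ> chart_inv ?c) x" by simp
  qed
  then have "differential A F p v = 0" for v
    unfolding differential_def Let_def by (simp flip: frechet_derivative_at)
  then show "contact_bracket A \<alpha> F G p = 0" using F0[OF p] by (simp add: contact_bracket_def)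
qed

lemma vanishing_ideal_bracket:
  assumes "submanifold A Y" "contact_coisotropic A \<alpha> Y" "F \<in> vanishing_ideal A Y" "G \<in> vanishing_ideal A Y"
    and p: "p \<in> Y"
  shows "contact_bracket A \<alpha> F G p = 0"
proof -
  obtain c S where c: "slice_chart A Y c S" "p \<in> chart_dom c"
    using assms(1) p unfolding submanifold_def by blast
  note iff = sub_tangent_space_iff(2)[OF c(1) p c(2)]
  let ?X = "contact_vector_field A \<alpha> G p" and ?T = "sub_tangent_space A Y p"
  have G: "smooth_function A G" "G p = 0"
    using assms(4) p by (auto simp: vanishing_ideal_def compactly_supported_smooth_def)
  note X = contact_vector_field[OF G(1), where p = p]
  have "?X \<in> symplectic_orthogonal A \<alpha> p (?T \<inter> contact_hyperplane A \<alpha> p)"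
    unfolding symplectic_orthogonal_def contact_hyperplane_def
    using X G(2) iff assms(4) by auto
  then have "?X \<in> ?T" using assms(2) p unfolding contact_coisotropic_def by blast
  then have "differential A F p ?X = 0" using iff assms(3) by blast
  moreover have "F p = 0" using assms(3) p by (simp add: vanishing_ideal_def)
  ultimately show ?thesis by (simp add: contact_bracket_def)
qed

text \<open>The differential of \<open>G\<close> has to agree with \<open>- d\<alpha>(v, _)\<close> on \<open>\<xi>\<^sub>p\<close> and to vanish on \<open>T\<^sub>pY\<close>. Among the covectors
  with the first property, which differ by multiples of \<open>\<alpha>\<close>, one kills \<open>T\<^sub>pY\<close> because \<open>v\<close> is orthogonal to
  \<open>T\<^sub>pY \<inter> \<xi>\<^sub>p\<close>.\<close>

lemma orthogonal_is_contact_vector: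
  assumes "slice_chart A Y c S" "p \<in> Y" "p \<in> chart_dom c"
    and v: "v \<in> symplectic_orthogonal A \<alpha> p (sub_tangent_space A Y p \<inter> contact_hyperplane A \<alpha> p)"
  obtains G where "G \<in> vanishing_ideal A Y" "contact_vector_field A \<alpha> G p = v"
proof -
  have c: "c \<in> charts_at A p" "c \<in> A" "chart_map c p \<in> chart_ran c"
    using assms by (auto simp: slice_chart_def charts_at_iff)
  have S: "subspace S" using assms(1) by (simp add: slice_chart_def)
  let ?a = "lrep c (chart_map c p)" and ?B = "dlrep c (chart_map c p)"
  interpret contact_pair ?a ?B by (rule contact_pair_in_chart[OF c(2,3)])
  have vT: "v \<in> tangent_space A p" "\<alpha> p v = 0"
    using v by (auto simp: symplectic_orthogonal_def contact_hyperplane_def)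
  have orth: "?B (v c) w = 0" if "w \<in> S" "?a w = 0" for w
  proof -
    let ?w = "tvector_of A c p w"
    have w: "?w \<in> tangent_space A p" by (rule tvector_of_in[OF c(1)])
    have "?w \<in> sub_tangent_space A Y p" using sub_tangent_space_iff(1)[OF assms(1-3)] w that(1) c(1) by simp
    moreover have "?w \<in> contact_hyperplane A \<alpha> p"
      using alpha_eq_lrep[OF w c(1)] w that(2) c(1) by (simp add: contact_hyperplane_def)
    ultimately have "ext_deriv A \<alpha> p v ?w = 0" using v by (auto simp: symplectic_orthogonal_def)
    then show ?thesis using ext_deriv_eq_dlrep[OF vT(1) w c(1)] c(1) by simp
  qed
  \<comment> \<open>If \<open>T\<^sub>pY\<close> contains a vector \<open>s\<close> outside \<open>\<xi>\<^sub>p\<close>, it is spanned by \<open>s\<close> and \<open>T\<^sub>pY \<inter> \<xi>\<^sub>p\<close>, and \<open>\<kappa>\<close> is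
      determined by \<open>s\<close>; otherwise \<open>v\<close> is orthogonal to all of \<open>T\<^sub>pY\<close>.\<close>
  obtain \<kappa> where \<kappa>: "\<And>w. w \<in> S \<Longrightarrow> ?B (v c) w = \<kappa> * ?a w"
  proof (cases "\<exists>s\<in>S. ?a s \<noteq> 0")
    case True
    then obtain s where s: "s \<in> S" "?a s \<noteq> 0" by blast
    interpret Bv: linear "?B (v c)" by (rule linear_B)
    have "?B (v c) w = (?B (v c) s / ?a s) * ?a w" if "w \<in> S" for w
    proof -
      have "w - (?a w / ?a s) *\<^sub>R s \<in> S" using S s that by (intro subspace_diff subspace_scale)
      moreover have "?a (w - (?a w / ?a s) *\<^sub>R s) = 0" using s by (simp add: a.diff a.scaleR)
      ultimately have "?B (v c) (w - (?a w / ?a s) *\<^sub>R s) = 0" by (rule orth)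
      then show ?thesis by (simp add: Bv.diff Bv.scaleR)
    qed
    then show thesis by (rule that)
  next
    case False
    then have "?B (v c) w = 0 * ?a w" if "w \<in> S" for w using orth that by simp
    then show thesis by (rule that)
  qed
  define l where "l = (\<lambda>w. \<kappa> * ?a w - ?B (v c) w)"
  have "linear l" unfolding l_def
    using linear_compose_sub[OF linear_compose_scale_right[OF linear_a, of \<kappa>] linear_B(2)[of "v c"]] by simp
  moreover have "l x = 0" if "x \<in> S" for x using \<kappa>[OF that] by (simp add: l_def)
  ultimately obtain G where G: "G \<in> vanishing_ideal A Y"
    "\<And>w. w \<in> tangent_space A p \<Longrightarrow> differential A G p w = l (w c)"
    using slice_chart_extension[OF assms(1-3)] by metis
  have lR: "l (reeb A \<alpha> p c) = \<kappa>"
    using reeb_in_chart[OF c(1)] skew[of "v c" "reeb A \<alpha> p c"] by (simp add: l_def)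
  have "contact_vector_field A \<alpha> G p = v"
  proof (rule contact_vector_fieldI)
    show "smooth_function A G" using G(1) by (simp add: vanishing_ideal_def compactly_supported_smooth_def)
    show "\<alpha> p v = G p" using vT(2) G(1) assms(2) by (simp add: vanishing_ideal_def)
    show "ext_deriv A \<alpha> p v w = differential A G p (reeb A \<alpha> p) * \<alpha> p w - differential A G p w"
      if w: "w \<in> tangent_space A p" for w
      unfolding G(2)[OF w] G(2)[OF reeb_tangent] lR ext_deriv_eq_dlrep[OF vT(1) w c(1)]
        alpha_eq_lrep[OF w c(1)] by (simp add: l_def)
  qed (rule vT(1))
  with G(1) show thesis by (rule that)
qed

lemma coisotropic_iff_lie_subalgebra:
  assumes Y: "submanifold A Y"
  shows "contact_coisotropic A \<alpha> Y \<longleftrightarrow>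
    lie_subalgebra (contact_bracket A \<alpha>) (compactly_supported_smooth A) (vanishing_ideal A Y)"
proof
  assume co: "contact_coisotropic A \<alpha> Y"
  have "(\<lambda>_. 0) \<in> compactly_supported_smooth A"
    by (rule compactly_supported_smoothI[OF smooth_function_const, of "{}"]) auto
  moreover have "contact_bracket A \<alpha> F G \<in> vanishing_ideal A Y"
    if "F \<in> vanishing_ideal A Y" "G \<in> vanishing_ideal A Y" for F G
    using that vanishing_ideal_bracket[OF Y co that] contact_bracket_compactly_supported
    by (simp add: vanishing_ideal_def)
  ultimately show "lie_subalgebra (contact_bracket A \<alpha>) (compactly_supported_smooth A) (vanishing_ideal A Y)"
    unfolding lie_subalgebra_def
    using compact_support_add compact_support_scale by (auto simp: vanishing_ideal_def)
next
  assume lie: "lie_subalgebra (contact_bracket A \<alpha>) (compactly_supported_smooth A) (vanishing_ideal A Y)"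
  show "contact_coisotropic A \<alpha> Y" unfolding contact_coisotropic_def
  proof (intro ballI subsetI)
    fix p v assume p: "p \<in> Y"
      and v: "v \<in> symplectic_orthogonal A \<alpha> p (sub_tangent_space A Y p \<inter> contact_hyperplane A \<alpha> p)"
    obtain c S where c: "slice_chart A Y c S" "p \<in> chart_dom c"
      using Y p unfolding submanifold_def by blast
    obtain G where G: "G \<in> vanishing_ideal A Y" "contact_vector_field A \<alpha> G p = v"
      using orthogonal_is_contact_vector[OF c(1) p c(2) v] by blast
    have "differential A F p v = 0" if F: "F \<in> vanishing_ideal A Y" for F
    proof -
      have "contact_bracket A \<alpha> F G \<in> vanishing_ideal A Y"
        using lie F G(1) unfolding lie_subalgebra_def by blast
      then have "contact_bracket A \<alpha> F G p = 0" using p by (simp add: vanishing_ideal_def)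
      moreover have "F p = 0" using F p by (simp add: vanishing_ideal_def)
      ultimately show ?thesis using G(2) by (simp add: contact_bracket_def)
    qed
    then show "v \<in> sub_tangent_space A Y p \<inter> contact_hyperplane A \<alpha> p"
      using v sub_tangent_space_iff(2)[OF c(1) p c(2)]
      by (auto simp: symplectic_orthogonal_def contact_hyperplane_def)
  qed
qed

end

theorem proposition1p3:
  fixes A :: "('a::{t2_space, second_countable_topology}, 'e::euclidean_space) chart set"
    and n :: nat and \<alpha> :: "('a, 'e) one_form" and Y :: "'a set"
  assumes "contact_manifold A n \<alpha>"
    and "submanifold A Y"
  shows "contact_coisotropic A \<alpha> Y \<longleftrightarrow>
    lie_subalgebra (contact_bracket A \<alpha>) (compactly_supported_smooth A) (vanishing_ideal A Y)"
proof -
  interpret contact_atlas A \<alpha> n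
    by unfold_locales (use assms(1) in \<open>auto simp: contact_manifold_def\<close>)
  show ?thesis by (rule coisotropic_iff_lie_subalgebra[OF assms(2)])
qed

end
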